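(* Let $(M,L)$ be a generalized Ricci Finsler manifold of dimension $n\ge 3$ with associated scalar $\alpha$; that is, the horizontal Ricci tensor $\mathrm{Ric}$ is non-zero and $\mathrm{Ric}_o\circ \mathrm{Ric}_o=\alpha\,\mathrm{Ric}_o$, where $\alpha$ is a non-zero scalar function on $TM$. The following assertions hold: (a) If the Ricci tensor $\mathrm{Ric}$ is symmetric, then the horizontal scalar curvature $r$ cannot vanish. (b) The Ricci tensor in the direction $\mathrm{Ric}_o(\overline{W})$, $\overline W$ being a non-zero $\pi$-vector field, is the associated scalar $\alpha$. (c) The tensor $\mathrm{Ric}_o$ has two eigenvalues $0$ and $\alpha$. (d) If $(M,L)$ is horizontally integrable and Ricci recurrent, then the associated scalar is $\alpha=\frac{r}{2}$.
   Context: Setting. $(M,L)$ is a smooth Finsler manifold of dimension $n$ (with positive definite Finsler metric), $\mathcal{T}M$ is the bundle of nonzero tangent vectors, $\pi:\mathcal{T}M\to M$, and $\pi^{-1}(TM)\to\mathcal{T}M$ is the pullback bundle, whose sections $\overline X$ are called $\pi$-vector fields (tensor fields and 1-forms on this bundle are $\pi$-tensor fields and $\pi$-forms). $g$ is the Finsler metric on $\pi^{-1}(TM)$ defined by $L$ (in coordinates $g_{ij}=\frac12\partial^2L^2/\partial y^i\partial y^j$). $\overline\eta(u)=(u,u)$ is the fundamental $\pi$-vector field. $\rho:T(\mathcal{T}M)\to\pi^{-1}(TM)$ is the morphism induced by $d\pi$ and $\gamma:\pi^{-1}(TM)\to T(\mathcal{T}M)$ is the vertical lift. A linear connection $D$ on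 $\pi^{-1}(TM)$ is regular if $T_u(\mathcal{T}M)=V_u\oplus H_u$ for all $u$, where $V_u=\ker d\pi$ and $H_u=\{X: D_X\overline\eta=0\}$; then $\beta:=(\rho|_{H})^{-1}$ is its horizontal map. The Cartan connection $\nabla$ is the unique regular connection with $\nabla g=0$, $Q(\overline X,\overline Y):=\mathbf T(\beta\overline X,\beta\overline Y)=0$, and $T(\overline X,\overline Y):=\mathbf T(\gamma\overline X,\beta\overline Y)$ satisfying $g(T(\overline X,\overline Y),\overline Z)=g(T(\overline X,\overline Z),\overline Y)$, where $\mathbf T(X,Y)=\nabla_X\rho Y-\nabla_Y\rho X-\rho[X,Y]$. Curvature. $\mathbf K(X,Y)\overline Z=-\nabla_X\nabla_Y\overline Z+\nabla_Y\nabla_X\overline Z+\nabla_{[X,Y]}\overline Z$; $R(\overline X,\overline Y)\overline Z=\mathbf K(\beta\overline X,\beta\overline Y)\overline Z$; $\widehat R(\overline X,\overline Y)=R(\overline X,\overline Y)\overline\eta$. The horizontal Ricci tensor is $\mathrm{Ric}(\overline X,\overline Y)=\mathrm{trace}\{\overline Z\mapsto R(\overline X,\overline Z)\overline Y\}$; $\mathrm{Ric}_o$ is the $(1,1)$ tensor with $g(\mathrm{Ric}_o\overline X,\overline Y)=\mathrm{Ric}(\overline X,\overline Y)$; $r=\mathrm{trace}\,\mathrm{Ric}_o$ is the horizontal scalar curvature. The Ricci tensor in the direction $\overline V$ means the quotient $\mathrm{Ric}(\overline V,\overline V)/g(\overline V,\overline V)$. Definitions. $(M,L)$ is horizontally integrable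 if its horizontal distribution is completely integrable, equivalently $\widehat R=0$. $(M,L)$ with non-zero $\mathrm{Ric}$ is Ricci recurrent if $(\nabla_{\beta\overline X}\mathrm{Ric})(\overline Y,\overline Z)=A(\overline X)\,\mathrm{Ric}(\overline Y,\overline Z)$ for some non-zero $\pi$-form $A$ (the recurrence form).
   Formalization: In (c), where Ric_o = α·id (e.g. round spheres) the only eigenvalue is α; elsewhere they are exactly 0 and α. In (b), Ric_o(W) must be non-zero. "Non-zero" means nowhere zero for α, and not identically zero over any connected component for Ric and the recurrence form. *)

theory Defs
  imports "HOL-Analysis.Analysis"
begin

section \<open>Smooth maps and smooth manifolds\<close>

text \<open>The predicates below are meant for open sets \<open>S\<close>.\<close>

primrec Ck_on :: "nat \<Rightarrow> ('a::real_normed_vector \<Rightarrow> 'b::real_normed_vector) \<Rightarrow> 'a set \<Rightarrow> bool" where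
  "Ck_on 0 f S \<longleftrightarrow> continuous_on S f"
| "Ck_on (Suc k) f S \<longleftrightarrow>
     (\<forall>x\<in>S. f differentiable (at x)) \<and> (\<forall>v. Ck_on k (\<lambda>x. frechet_derivative f (at x) v) S)"

definition smooth_on :: "'a::real_normed_vector set \<Rightarrow> ('a \<Rightarrow> 'b::real_normed_vector) \<Rightarrow> bool" where
  "smooth_on S f \<longleftrightarrow> (\<forall>k. Ck_on k f S)"

text \<open>A chart is a domain together with a coordinate map.\<close>

type_synonym ('p, 'n) chart = "'p set \<times> ('p \<Rightarrow> real ^ 'n)"

definition transition :: "('p, 'n::finite) chart \<Rightarrow> ('p, 'n) chart \<Rightarrow> real ^ 'n \<Rightarrow> real ^ 'n" where
  "transition c d = snd d \<circ> inv_into (fst c) (snd c)"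

definition overlap :: "('p, 'n::finite) chart \<Rightarrow> ('p, 'n) chart \<Rightarrow> (real ^ 'n) set" where
  "overlap c d = snd c ` (fst c \<inter> fst d)"

definition smooth_manifold :: "'p topology \<Rightarrow> ('p, 'n::finite) chart set \<Rightarrow> bool" where
  "smooth_manifold M \<A> \<longleftrightarrow>
     Hausdorff_space M \<and> second_countable M \<and> \<Union> (fst ` \<A>) = topspace M \<and>
     (\<forall>c\<in>\<A>. openin M (fst c) \<and> open (snd c ` fst c) \<and>
        homeomorphic_map (subtopology M (fst c)) (top_of_set (snd c ` fst c)) (snd c)) \<and>
     (\<forall>c\<in>\<A>. \<forall>d\<in>\<A>. smooth_on (overlap c d) (transition c d))"


section \<open>The slit tangent bundle and fields on it\<close>

text \<open>
  A chart \<open>c\<close> of \<open>M\<close> induces the chart of \<open>TM\<close> with coordinates \<open>(x, y)\<close>, where \<open>x\<close> ranges over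
  the image of \<open>c\<close> and \<open>y\<close> is the fibre coordinate; \<open>slit c\<close> is the part of it with \<open>y \<noteq> 0\<close>. The
  coordinate change of \<open>TM\<close> is \<open>(x, y) \<mapsto> (\<tau> x, D\<tau>(x) y)\<close>, with \<open>\<tau>\<close> the one of \<open>M\<close>. All geometric
  objects on the slit tangent bundle (functions, \<open>\<pi>\<close>-tensor fields, connections) are given by
  their local expressions in these charts, i.e. by families indexed by the charts of \<open>M\<close> which
  obey the transformation law of the object. In a chart, a \<open>\<pi>\<close>-vector field is a map from \<open>(x, y)\<close>
  to \<open>real ^ 'n\<close> and a vector field on the slit tangent bundle is a map from \<open>(x, y)\<close> to
  \<open>real ^ 'n \<times> real ^ 'n\<close>.
\<close>

type_synonym 'n tcoord = "(real ^ 'n) \<times> (real ^ 'n)"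

definition slit :: "('p, 'n::finite) chart \<Rightarrow> 'n tcoord set" where
  "slit c = (snd c ` fst c) \<times> (- {0})"

definition dtransition ::
  "('p, 'n::finite) chart \<Rightarrow> ('p, 'n) chart \<Rightarrow> real ^ 'n \<Rightarrow> real ^ 'n \<Rightarrow> real ^ 'n" where
  "dtransition c d x = frechet_derivative (transition c d) (at x)"

definition tangent_transition ::
  "('p, 'n::finite) chart \<Rightarrow> ('p, 'n) chart \<Rightarrow> 'n tcoord \<Rightarrow> 'n tcoord" where
  "tangent_transition c d w = (transition c d (fst w), dtransition c d (fst w) (snd w))"

definition scalar_field ::
  "('p, 'n::finite) chart set \<Rightarrow> (('p, 'n) chart \<Rightarrow> 'n tcoord \<Rightarrow> real) \<Rightarrow> bool" where
  "scalar_field \<A> f \<longleftrightarrow>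
     (\<forall>c\<in>\<A>. smooth_on (slit c) (f c)) \<and>
     (\<forall>c\<in>\<A>. \<forall>d\<in>\<A>. \<forall>w \<in> overlap c d \<times> (- {0}). f d (tangent_transition c d w) = f c w)"

definition pi_form ::
  "('p, 'n::finite) chart set \<Rightarrow> (('p, 'n) chart \<Rightarrow> 'n tcoord \<Rightarrow> real ^ 'n \<Rightarrow> real) \<Rightarrow> bool" where
  "pi_form \<A> A \<longleftrightarrow>
     (\<forall>c\<in>\<A>. (\<forall>w \<in> slit c. linear (A c w)) \<and> (\<forall>v. smooth_on (slit c) (\<lambda>w. A c w v))) \<and>
     (\<forall>c\<in>\<A>. \<forall>d\<in>\<A>. \<forall>w \<in> overlap c d \<times> (- {0}). \<forall>v.
        A d (tangent_transition c d w) (dtransition c d (fst w) v) = A c w v)"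

text \<open>
  \<open>P c w\<close> is meant to say that a given tensor field does not vanish at the point with coordinates
  \<open>w\<close> in the chart \<open>c\<close>. The field is called non-zero if it does not vanish identically over any
  connected component of \<open>M\<close>; for connected \<open>M\<close> this says that it is not the zero field.
\<close>

definition nonzero_field ::
  "'p topology \<Rightarrow> ('p, 'n::finite) chart set \<Rightarrow> (('p, 'n) chart \<Rightarrow> 'n tcoord \<Rightarrow> bool) \<Rightarrow> bool" where
  "nonzero_field M \<A> P \<longleftrightarrow>
     (\<forall>C \<in> connected_components_of M. \<exists>c\<in>\<A>. \<exists>p \<in> C \<inter> fst c. \<exists>y. y \<noteq> 0 \<and> P c (snd c p, y))"


section \<open>Finsler manifolds\<close>

definition finsler_metric ::
  "('n::finite tcoord \<Rightarrow> real) \<Rightarrow> 'n tcoord \<Rightarrow> real ^ 'n \<Rightarrow> real ^ 'n \<Rightarrow> real" where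
  "finsler_metric L w a b =
     frechet_derivative
       (\<lambda>y. frechet_derivative (\<lambda>z. (L (fst w, z))\<^sup>2) (at y) a) (at (snd w)) b / 2"

definition finsler_manifold ::
  "'p topology \<Rightarrow> ('p, 'n::finite) chart set \<Rightarrow> (('p, 'n) chart \<Rightarrow> 'n tcoord \<Rightarrow> real) \<Rightarrow> bool" where
  "finsler_manifold M \<A> L \<longleftrightarrow>
     smooth_manifold M \<A> \<and>
     scalar_field \<A> L \<and>
     (\<forall>c\<in>\<A>.
        continuous_on ((snd c ` fst c) \<times> UNIV) (L c) \<and>
        (\<forall>w \<in> slit c. L c w > 0) \<and>
        (\<forall>x \<in> snd c ` fst c. \<forall>y. \<forall>t\<ge>0. L c (x, t *\<^sub>R y) = t * L c (x, y)) \<and>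
        (\<forall>w \<in> slit c. \<forall>a. a \<noteq> 0 \<longrightarrow> finsler_metric (L c) w a a > 0))"


section \<open>Linear connections on the pullback bundle\<close>

text \<open>
  In a chart a linear connection is \<open>D\<^sub>X Y = dY(X) + G(X, Y)\<close> with \<open>G\<close> a smooth field of bilinear
  maps (the connection coefficients), where \<open>X\<close> is a vector field on the slit tangent bundle and
  \<open>Y\<close> is a \<open>\<pi>\<close>-vector field.
\<close>

type_synonym 'n conn = "'n tcoord \<Rightarrow> 'n tcoord \<Rightarrow> real ^ 'n \<Rightarrow> real ^ 'n"

definition cov ::
  "'n::finite conn \<Rightarrow> ('n tcoord \<Rightarrow> 'n tcoord) \<Rightarrow> ('n tcoord \<Rightarrow> real ^ 'n) \<Rightarrow> 'n tcoord \<Rightarrow> real ^ 'n" where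
  "cov G X Y = (\<lambda>w. frechet_derivative Y (at w) (X w) + G w (X w) (Y w))"

text \<open>
  The transformation law expresses that the local operators \<open>cov (G c)\<close> and \<open>cov (G d)\<close> agree on
  the overlap: if \<open>Y\<^sub>d (T\<tau> w) = D\<tau> (Y\<^sub>c w)\<close>, then differentiating this relation in the direction
  \<open>\<xi>\<close> produces the term with the second derivative of \<open>\<tau>\<close>.
\<close>

definition linear_connection ::
  "('p, 'n::finite) chart set \<Rightarrow> (('p, 'n) chart \<Rightarrow> 'n conn) \<Rightarrow> bool" where
  "linear_connection \<A> G \<longleftrightarrow>
     (\<forall>c\<in>\<A>. (\<forall>w \<in> slit c. bilinear (G c w)) \<and>
        (\<forall>\<xi> z. smooth_on (slit c) (\<lambda>w. G c w \<xi> z))) \<and>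
     (\<forall>c\<in>\<A>. \<forall>d\<in>\<A>. \<forall>w \<in> overlap c d \<times> (- {0}). \<forall>\<xi> z.
        G d (tangent_transition c d w)
            (frechet_derivative (tangent_transition c d) (at w) \<xi>)
            (dtransition c d (fst w) z)
        = dtransition c d (fst w) (G c w \<xi> z)
          - frechet_derivative (\<lambda>x. dtransition c d x z) (at (fst w)) (fst \<xi>))"

text \<open>
  In a chart, \<open>\<rho>\<close> is \<open>fst\<close> (applied to values), the vertical lift \<open>\<gamma>\<close> is \<open>Y \<mapsto> (0, Y)\<close>, and the
  fundamental \<open>\<pi>\<close>-vector field is \<open>(x, y) \<mapsto> y\<close>, i.e. \<open>snd\<close>.
\<close>

definition rho :: "('n::finite tcoord \<Rightarrow> 'n tcoord) \<Rightarrow> 'n tcoord \<Rightarrow> real ^ 'n" where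
  "rho X = (\<lambda>w. fst (X w))"

definition gam :: "('n::finite tcoord \<Rightarrow> real ^ 'n) \<Rightarrow> 'n tcoord \<Rightarrow> 'n tcoord" where
  "gam Y = (\<lambda>w. (0, Y w))"

definition eta :: "'n::finite tcoord \<Rightarrow> real ^ 'n" where
  "eta w = snd w"

definition vertical_space :: "'n::finite tcoord set" where
  "vertical_space = {\<xi>. fst \<xi> = 0}"

definition horizontal_space :: "'n::finite conn \<Rightarrow> 'n tcoord \<Rightarrow> 'n tcoord set" where
  "horizontal_space G w = {\<xi>. cov G (\<lambda>_. \<xi>) eta w = 0}"

definition regular_connection :: "'n::finite tcoord set \<Rightarrow> 'n conn \<Rightarrow> bool" where
  "regular_connection S G \<longleftrightarrow>
     (\<forall>w\<in>S. vertical_space \<inter> horizontal_space G w = {0} \<and>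
        (\<forall>\<xi>. \<exists>v \<in> vertical_space. \<exists>h \<in> horizontal_space G w. \<xi> = v + h))"

definition beta ::
  "'n::finite conn \<Rightarrow> ('n tcoord \<Rightarrow> real ^ 'n) \<Rightarrow> 'n tcoord \<Rightarrow> 'n tcoord" where
  "beta G Y = (\<lambda>w. inv_into (horizontal_space G w) fst (Y w))"

definition bracket ::
  "('n::finite tcoord \<Rightarrow> 'n tcoord) \<Rightarrow> ('n tcoord \<Rightarrow> 'n tcoord) \<Rightarrow> 'n tcoord \<Rightarrow> 'n tcoord" where
  "bracket X Y =
     (\<lambda>w. frechet_derivative Y (at w) (X w) - frechet_derivative X (at w) (Y w))"

definition torsion ::
  "'n::finite conn \<Rightarrow> ('n tcoord \<Rightarrow> 'n tcoord) \<Rightarrow> ('n tcoord \<Rightarrow> 'n tcoord) \<Rightarrow> 'n tcoord \<Rightarrow> real ^ 'n" where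
  "torsion G X Y = (\<lambda>w. cov G X (rho Y) w - cov G Y (rho X) w - rho (bracket X Y) w)"

text \<open>Covariant derivative \<open>(D\<^sub>X B)(Y, Z)\<close> of a \<open>\<pi>\<close>-tensor field \<open>B\<close> of type \<open>(0, 2)\<close>.\<close>

definition cov_tensor ::
  "'n::finite conn \<Rightarrow> ('n tcoord \<Rightarrow> 'n tcoord) \<Rightarrow> ('n tcoord \<Rightarrow> real ^ 'n \<Rightarrow> real ^ 'n \<Rightarrow> real) \<Rightarrow>
     ('n tcoord \<Rightarrow> real ^ 'n) \<Rightarrow> ('n tcoord \<Rightarrow> real ^ 'n) \<Rightarrow> 'n tcoord \<Rightarrow> real" where
  "cov_tensor G X B Y Z =
     (\<lambda>w. frechet_derivative (\<lambda>u. B u (Y u) (Z u)) (at w) (X w)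
          - B w (cov G X Y w) (Z w) - B w (Y w) (cov G X Z w))"

definition cartan_connection ::
  "('p, 'n::finite) chart set \<Rightarrow> (('p, 'n) chart \<Rightarrow> 'n tcoord \<Rightarrow> real) \<Rightarrow>
     (('p, 'n) chart \<Rightarrow> 'n conn) \<Rightarrow> bool" where
  "cartan_connection \<A> L G \<longleftrightarrow>
     linear_connection \<A> G \<and>
     (\<forall>c\<in>\<A>.
        regular_connection (slit c) (G c) \<and>
        (\<forall>X Y Z. smooth_on (slit c) X \<and> smooth_on (slit c) Y \<and> smooth_on (slit c) Z \<longrightarrow>
           (\<forall>w \<in> slit c. cov_tensor (G c) X (finsler_metric (L c)) Y Z w = 0)) \<and>
        (\<forall>X Y. smooth_on (slit c) X \<and> smooth_on (slit c) Y \<longrightarrow>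
           (\<forall>w \<in> slit c. torsion (G c) (beta (G c) X) (beta (G c) Y) w = 0)) \<and>
        (\<forall>X Y Z. smooth_on (slit c) X \<and> smooth_on (slit c) Y \<and> smooth_on (slit c) Z \<longrightarrow>
           (\<forall>w \<in> slit c.
              finsler_metric (L c) w (torsion (G c) (gam X) (beta (G c) Y) w) (Z w) =
              finsler_metric (L c) w (torsion (G c) (gam X) (beta (G c) Z) w) (Y w))))"


section \<open>Curvature and Ricci tensors\<close>

definition curvature ::
  "'n::finite conn \<Rightarrow> ('n tcoord \<Rightarrow> 'n tcoord) \<Rightarrow> ('n tcoord \<Rightarrow> 'n tcoord) \<Rightarrow>
     ('n tcoord \<Rightarrow> real ^ 'n) \<Rightarrow> 'n tcoord \<Rightarrow> real ^ 'n" where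
  "curvature G X Y Z =
     (\<lambda>w. - cov G X (cov G Y Z) w + cov G Y (cov G X Z) w + cov G (bracket X Y) Z w)"

text \<open>
  The value of the h-curvature tensor on vectors: as the curvature is tensorial, it may be computed
  with the sections which extend the given vectors constantly in the chart.
\<close>

definition h_curvature ::
  "'n::finite conn \<Rightarrow> 'n tcoord \<Rightarrow> real ^ 'n \<Rightarrow> real ^ 'n \<Rightarrow> real ^ 'n \<Rightarrow> real ^ 'n" where
  "h_curvature G w a b z = curvature G (beta G (\<lambda>_. a)) (beta G (\<lambda>_. b)) (\<lambda>_. z) w"

definition R_hat ::
  "'n::finite conn \<Rightarrow> 'n tcoord \<Rightarrow> real ^ 'n \<Rightarrow> real ^ 'n \<Rightarrow> real ^ 'n" where
  "R_hat G w a b = h_curvature G w a b (eta w)"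

definition Ric :: "'n::finite conn \<Rightarrow> 'n tcoord \<Rightarrow> real ^ 'n \<Rightarrow> real ^ 'n \<Rightarrow> real" where
  "Ric G w a b = trace (matrix (\<lambda>z. h_curvature G w a z b))"

definition Ric_o ::
  "('n::finite tcoord \<Rightarrow> real) \<Rightarrow> 'n conn \<Rightarrow> 'n tcoord \<Rightarrow> real ^ 'n \<Rightarrow> real ^ 'n" where
  "Ric_o L G w a = (THE v. \<forall>b. finsler_metric L w v b = Ric G w a b)"

definition h_scalar :: "('n::finite tcoord \<Rightarrow> real) \<Rightarrow> 'n conn \<Rightarrow> 'n tcoord \<Rightarrow> real" where
  "h_scalar L G w = trace (matrix (Ric_o L G w))"

definition Ric_direction ::
  "('n::finite tcoord \<Rightarrow> real) \<Rightarrow> 'n conn \<Rightarrow> 'n tcoord \<Rightarrow> real ^ 'n \<Rightarrow> real" where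
  "Ric_direction L G w v = Ric G w v v / finsler_metric L w v v"

definition eigenvalues :: "('a::real_vector \<Rightarrow> 'a) \<Rightarrow> real set" where
  "eigenvalues f = {l. \<exists>v. v \<noteq> 0 \<and> f v = l *\<^sub>R v}"

definition ricci_symmetric ::
  "('p, 'n::finite) chart set \<Rightarrow> (('p, 'n) chart \<Rightarrow> 'n conn) \<Rightarrow> bool" where
  "ricci_symmetric \<A> G \<longleftrightarrow> (\<forall>c\<in>\<A>. \<forall>w \<in> slit c. \<forall>a b. Ric (G c) w a b = Ric (G c) w b a)"

definition nonzero_ricci ::
  "'p topology \<Rightarrow> ('p, 'n::finite) chart set \<Rightarrow> (('p, 'n) chart \<Rightarrow> 'n conn) \<Rightarrow> bool" where
  "nonzero_ricci M \<A> G \<longleftrightarrow> nonzero_field M \<A> (\<lambda>c w. \<exists>a b. Ric (G c) w a b \<noteq> 0)"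

definition generalized_ricci ::
  "'p topology \<Rightarrow> ('p, 'n::finite) chart set \<Rightarrow> (('p, 'n) chart \<Rightarrow> 'n tcoord \<Rightarrow> real) \<Rightarrow>
     (('p, 'n) chart \<Rightarrow> 'n conn) \<Rightarrow> (('p, 'n) chart \<Rightarrow> 'n tcoord \<Rightarrow> real) \<Rightarrow> bool" where
  "generalized_ricci M \<A> L G \<alpha> \<longleftrightarrow>
     nonzero_ricci M \<A> G \<and>
     scalar_field \<A> \<alpha> \<and>
     (\<forall>c\<in>\<A>. \<forall>w \<in> slit c. \<alpha> c w \<noteq> 0) \<and>
     (\<forall>c\<in>\<A>. \<forall>w \<in> slit c. \<forall>a.
        Ric_o (L c) (G c) w (Ric_o (L c) (G c) w a) = \<alpha> c w *\<^sub>R Ric_o (L c) (G c) w a)"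

definition horizontally_integrable ::
  "('p, 'n::finite) chart set \<Rightarrow> (('p, 'n) chart \<Rightarrow> 'n conn) \<Rightarrow> bool" where
  "horizontally_integrable \<A> G \<longleftrightarrow> (\<forall>c\<in>\<A>. \<forall>w \<in> slit c. \<forall>a b. R_hat (G c) w a b = 0)"

definition ricci_recurrent ::
  "'p topology \<Rightarrow> ('p, 'n::finite) chart set \<Rightarrow> (('p, 'n) chart \<Rightarrow> 'n conn) \<Rightarrow> bool" where
  "ricci_recurrent M \<A> G \<longleftrightarrow>
     nonzero_ricci M \<A> G \<and>
     (\<exists>A. pi_form \<A> A \<and> nonzero_field M \<A> (\<lambda>c w. \<exists>v. A c w v \<noteq> 0) \<and>
        (\<forall>c\<in>\<A>. \<forall>X Y Z.
           smooth_on (slit c) X \<and> smooth_on (slit c) Y \<and> smooth_on (slit c) Z \<longrightarrow>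
           (\<forall>w \<in> slit c. cov_tensor (G c) (beta (G c) X) (Ric (G c)) Y Z w
              = A c w (X w) * Ric (G c) w (Y w) (Z w))))"

end

theory Submission
  imports Defs
begin

text \<open>
  Everything but the fourth assertion is linear algebra at a point, once it is known that the Ricci
  operator \<open>A = Ric\<^sub>o\<close> vanishes nowhere. As \<open>A \<circ> A = \<alpha> A\<close> with \<open>\<alpha> \<noteq> 0\<close>, the map \<open>A / \<alpha>\<close> is idempotent, so the
  eigenvalues of \<open>A\<close> are among \<open>0\<close> and \<open>\<alpha>\<close>, and \<open>r / \<alpha>\<close>, being the trace of an idempotent, is its
  rank (\<open>trace_scaled_idempotent\<close>, \<open>eigenvalues_scaled_idempotent\<close>). The rank is a natural number which
  depends continuously on the point of the slit tangent bundle, whose fibres are connected. Hence it is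
  constant over each connected component of \<open>M\<close> (\<open>natural_scalar_constant_on_component\<close>), and it is
  positive at some point of each of them, because \<open>Ric\<close> is not zero there. Hence \<open>r\<close> and \<open>A\<close> vanish nowhere.

  For the last assertion it is enough that the rank is \<open>2\<close> at one point over each component. At a point
  where the recurrence form \<open>\<kappa>\<close> does not vanish, contract the second Bianchi identity twice. Horizontal
  integrability makes this identity the classical one, without torsion terms, and recurrence replaces the
  derivatives of \<open>Ric\<close> by multiples of \<open>Ric\<close>; the result is \<open>r \<kappa> = 2 \<kappa> \<circ> A\<close> (\<open>recurrence_form_eigen\<close>).
  Composing with \<open>A\<close> gives \<open>r (\<kappa> \<circ> A) = 2 \<alpha> (\<kappa> \<circ> A)\<close>, and \<open>\<kappa> \<circ> A = r \<kappa> / 2 \<noteq> 0\<close>, so \<open>r = 2 \<alpha>\<close>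
  (\<open>associated_scalar_of_recurrence\<close>).

  All objects are families of local expressions, so two groups of facts have to be supplied in
  coordinates. The horizontal map and the Ricci operator are smooth, as solutions of smooth linear systems
  (\<open>smooth_on_solution_linear_system\<close>), and \<open>r\<close> is independent of the chart,
  because the transformation law of the connection implies those of the curvature and of \<open>Ric\<close>
  (\<open>coordinate_change\<close>).
\<close>

section \<open>Calculus of smooth maps\<close>

abbreviation dd :: "('a::real_normed_vector \<Rightarrow> 'b::real_normed_vector) \<Rightarrow> 'a \<Rightarrow> 'a \<Rightarrow> 'b" where
  "dd f w v \<equiv> frechet_derivative f (at w) v"

lemma frechet_derivative_eq:
  "(f has_derivative f') (at x) \<Longrightarrow> frechet_derivative f (at x) = f'"
  using frechet_derivative_at by metis

lemma frechet_derivative_cong_open: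
  assumes "open S" "x \<in> S" "\<And>u. u \<in> S \<Longrightarrow> f u = g u"
  shows "frechet_derivative f (at x) = frechet_derivative g (at x)"
proof -
  have "(f has_derivative f') (at x) \<longleftrightarrow> (g has_derivative f') (at x)" for f'
    using has_derivative_transform_within_open[OF _ assms(1,2)] assms(3) by metis
  then show ?thesis
    by (simp add: frechet_derivative_def)
qed

lemma differentiable_cong_open:
  assumes "open S" "x \<in> S" "\<And>u. u \<in> S \<Longrightarrow> f u = g u" "f differentiable (at x)"
  shows "g differentiable (at x)"
  using assms has_derivative_transform_within_open[of f _ x UNIV S g]
  unfolding differentiable_def by metis

lemma Ck_on_cong:
  assumes "open S" "\<And>u. u \<in> S \<Longrightarrow> f u = g u" "Ck_on k f S"
  shows "Ck_on k g S"
  using assms(2,3)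
proof (induction k arbitrary: f g)
  case 0
  then show ?case by (simp cong: continuous_on_cong)
next
  case (Suc k)
  have "g differentiable (at x)" if "x \<in> S" for x
    using differentiable_cong_open[OF assms(1) that Suc.prems(1)] Suc.prems(2) that by simp
  moreover have "Ck_on k (\<lambda>x. dd g x v) S" for v
  proof (rule Suc.IH)
    show "dd f x v = dd g x v" if "x \<in> S" for x
      using frechet_derivative_cong_open[OF assms(1) that Suc.prems(1)] by simp
    show "Ck_on k (\<lambda>x. dd f x v) S"
      using Suc.prems(2) by simp
  qed
  ultimately show ?case by simp
qed

lemma Ck_on_Suc_imp: "Ck_on (Suc k) f S \<Longrightarrow> Ck_on k f S"
proof (induction k arbitrary: f)
  case 0
  then show ?case
    by (auto intro!: continuous_at_imp_continuous_on differentiable_imp_continuous_within)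
next
  case (Suc k)
  from Suc.prems have "\<forall>x\<in>S. f differentiable (at x)"
    and "Ck_on (Suc k) (\<lambda>x. dd f x v) S" for v
    using Ck_on.simps(2)[of "Suc k" f S] by blast+
  then show ?case
    using Suc.IH by simp
qed

lemma smooth_on_cong:
  "open S \<Longrightarrow> smooth_on S f \<Longrightarrow> (\<And>u. u \<in> S \<Longrightarrow> f u = g u) \<Longrightarrow> smooth_on S g"
  unfolding smooth_on_def using Ck_on_cong by blast

lemma smooth_on_differentiable: "smooth_on S f \<Longrightarrow> w \<in> S \<Longrightarrow> f differentiable (at w)"
  unfolding smooth_on_def using Ck_on.simps(2) by blast

lemma smooth_on_has_derivative:
  "smooth_on S f \<Longrightarrow> w \<in> S \<Longrightarrow> (f has_derivative dd f w) (at w)"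
  using smooth_on_differentiable frechet_derivative_works by blast

lemma smooth_on_dd: "smooth_on S f \<Longrightarrow> smooth_on S (\<lambda>w. dd f w v)"
  unfolding smooth_on_def using Ck_on.simps(2) by blast

lemma smooth_on_continuous: "smooth_on S f \<Longrightarrow> continuous_on S f"
  unfolding smooth_on_def using Ck_on.simps(1) by blast

lemma smooth_on_const [simp]: "smooth_on S (\<lambda>_. c)"
proof -
  have "Ck_on k (\<lambda>_. c) S" for k and c :: 'b
    by (induction k arbitrary: c) auto
  then show ?thesis by (simp add: smooth_on_def)
qed

lemma smooth_on_bounded_linear_comp:
  assumes "open S" "bounded_linear l" "smooth_on S f"
  shows "smooth_on S (\<lambda>w. l (f w))"
proof -
  have "Ck_on k f S \<Longrightarrow> Ck_on k (\<lambda>w. l (f w)) S" for k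
  proof (induction k arbitrary: f)
    case 0
    then show ?case
      using bounded_linear.continuous_on[OF assms(2)] by auto
  next
    case (Suc k)
    have der: "((\<lambda>w. l (f w)) has_derivative (\<lambda>v. l (dd f x v))) (at x)" if "x \<in> S" for x
      using bounded_linear.has_derivative[OF assms(2)] Suc.prems that
      by (auto simp: frechet_derivative_works)
    have "Ck_on k (\<lambda>x. dd (\<lambda>w. l (f w)) x v) S" for v
      by (rule Ck_on_cong[OF assms(1) _ Suc.IH[of "\<lambda>x. dd f x v"]])
         (use der frechet_derivative_eq Suc.prems in force)+
    then show ?case
      using der by (auto simp: differentiable_def)
  qed
  then show ?thesis
    using assms(3) by (simp add: smooth_on_def)
qed

lemma Ck_on_add:
  assumes "open S" "Ck_on k f S" "Ck_on k g S"
  shows "Ck_on k (\<lambda>w. f w + g w) S"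
  using assms(2,3)
proof (induction k arbitrary: f g)
  case 0
  then show ?case by (auto intro: continuous_on_add)
next
  case (Suc k)
  have der: "((\<lambda>w. f w + g w) has_derivative (\<lambda>v. dd f x v + dd g x v)) (at x)" if "x \<in> S" for x
    using has_derivative_add Suc.prems that by (auto simp: frechet_derivative_works)
  have "Ck_on k (\<lambda>x. dd (\<lambda>w. f w + g w) x v) S" for v
    by (rule Ck_on_cong[OF assms(1) _ Suc.IH[of "\<lambda>x. dd f x v" "\<lambda>x. dd g x v"]])
       (use der frechet_derivative_eq Suc.prems in force)+
  then show ?case
    using der by (auto simp: differentiable_def)
qed

lemma smooth_on_add:
  "open S \<Longrightarrow> smooth_on S f \<Longrightarrow> smooth_on S g \<Longrightarrow> smooth_on S (\<lambda>w. f w + g w)"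
  unfolding smooth_on_def using Ck_on_add by blast

text \<open>
  The Leibniz rule reduces the order \<open>k + 1\<close> for a product to the order \<open>k\<close> for two products, so
  the factors have to be arbitrary in the induction.
\<close>

lemma Ck_on_bilinear:
  assumes "open S" "bounded_bilinear h" "Ck_on k f S" "Ck_on k g S"
  shows "Ck_on k (\<lambda>w. h (f w) (g w)) S"
  using assms(3,4)
proof (induction k arbitrary: f g)
  case 0
  then show ?case using bounded_bilinear.continuous_on[OF assms(2)] by auto
next
  case (Suc k)
  have der: "((\<lambda>w. h (f w) (g w)) has_derivative (\<lambda>v. h (f x) (dd g x v) + h (dd f x v) (g x))) (at x)"
    if "x \<in> S" for x
    by (rule bounded_bilinear.FDERIV[OF assms(2)])
       (use Suc.prems that in \<open>auto simp: frechet_derivative_works\<close>)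
  have "Ck_on k (\<lambda>x. dd (\<lambda>w. h (f w) (g w)) x v) S" for v
  proof (rule Ck_on_cong[OF assms(1)])
    show "h (f x) (dd g x v) + h (dd f x v) (g x) = dd (\<lambda>w. h (f w) (g w)) x v" if "x \<in> S" for x
      using frechet_derivative_eq[OF der[OF that]] by simp
    show "Ck_on k (\<lambda>x. h (f x) (dd g x v) + h (dd f x v) (g x)) S"
      using Suc.prems Ck_on_Suc_imp[OF Suc.prems(1)] Ck_on_Suc_imp[OF Suc.prems(2)]
      by (intro Ck_on_add[OF assms(1)] Suc.IH) auto
  qed
  then show ?case
    using der by (auto simp: differentiable_def)
qed

lemma smooth_on_bilinear:
  "open S \<Longrightarrow> bounded_bilinear h \<Longrightarrow> smooth_on S f \<Longrightarrow> smooth_on S g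
    \<Longrightarrow> smooth_on S (\<lambda>w. h (f w) (g w))"
  unfolding smooth_on_def using Ck_on_bilinear by blast

lemmas smooth_on_scaleR = smooth_on_bilinear[OF _ bounded_bilinear_scaleR]
lemmas smooth_on_mult = smooth_on_bilinear[OF _ bounded_bilinear_mult]
lemmas smooth_on_minus = smooth_on_bounded_linear_comp[OF _ bounded_linear_minus[OF bounded_linear_ident]]

lemma smooth_on_diff:
  "open S \<Longrightarrow> smooth_on S f \<Longrightarrow> smooth_on S g \<Longrightarrow> smooth_on S (\<lambda>w. f w - g w)"
  using smooth_on_add[of S f "\<lambda>w. - g w"] smooth_on_minus[of S g] by simp

lemma smooth_on_sum:
  assumes "open S" "\<And>i. i \<in> I \<Longrightarrow> smooth_on S (f i)"
  shows "smooth_on S (\<lambda>w. \<Sum>i\<in>I. f i w)"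
  using assms(2) by (induction I rule: infinite_finite_induct) (auto intro: smooth_on_add[OF assms(1)])

lemma smooth_on_prod:
  fixes f :: "'i \<Rightarrow> 'a::real_normed_vector \<Rightarrow> real"
  assumes "open S" "\<And>i. i \<in> I \<Longrightarrow> smooth_on S (f i)"
  shows "smooth_on S (\<lambda>w. \<Prod>i\<in>I. f i w)"
  using assms(2) by (induction I rule: infinite_finite_induct) (auto intro: smooth_on_mult[OF assms(1)])

lemma smooth_on_linear:
  fixes l :: "'a::real_normed_vector \<Rightarrow> 'b::real_normed_vector"
  assumes "open S" "bounded_linear l" shows "smooth_on S l"
proof -
  have "Ck_on k (\<lambda>w. l w) S" for k
  proof (cases k)
    case 0
    then show ?thesis by (simp add: assms(2) linear_continuous_on)
  next
    case (Suc m)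
    have der: "(l has_derivative l) (at w)" for w
      using assms(2) by (simp add: bounded_linear_imp_has_derivative)
    then have "dd l w v = l v" for w v
      using frechet_derivative_eq by metis
    moreover have "Ck_on m (\<lambda>w. l v) S" for v
      using smooth_on_const[of S "l v"] unfolding smooth_on_def by blast
    moreover have "l differentiable (at w)" for w
      using der[of w] by (rule differentiableI)
    ultimately show ?thesis
      by (simp add: Suc)
  qed
  then show ?thesis by (simp add: smooth_on_def)
qed

lemma smooth_on_Pair:
  assumes "open S" "smooth_on S f" "smooth_on S g"
  shows "smooth_on S (\<lambda>w. (f w, g w))"
proof -
  have "smooth_on S (\<lambda>w. (f w, 0) + (0, g w))"
    by (intro smooth_on_add smooth_on_bounded_linear_comp[OF assms(1) _ assms(2), of "\<lambda>a. (a, 0)"]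
        smooth_on_bounded_linear_comp[OF assms(1) _ assms(3), of "\<lambda>a. (0, a)"] assms(1)
        bounded_linear_Pair bounded_linear_ident bounded_linear_zero)
  then show ?thesis by simp
qed

lemma smooth_on_inverse:
  fixes f :: "'a::real_normed_vector \<Rightarrow> real"
  assumes "open S" "smooth_on S f" "\<And>w. w \<in> S \<Longrightarrow> f w \<noteq> 0"
  shows "smooth_on S (\<lambda>w. inverse (f w))"
proof -
  have "Ck_on k (\<lambda>w. inverse (f w)) S" for k
  proof (induction k)
    case 0
    then show ?case
      using smooth_on_continuous[OF assms(2)] assms(3) by (auto intro: continuous_on_inverse)
  next
    case (Suc k)
    have der: "((\<lambda>w. inverse (f w)) has_derivative
        (\<lambda>v. - dd f x v * (inverse (f x) * inverse (f x)))) (at x)" if "x \<in> S" for x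
      by (rule has_derivative_eq_rhs[OF Deriv.has_derivative_inverse[OF assms(3)[OF that]
              smooth_on_has_derivative[OF assms(2) that]]]) (auto simp: fun_eq_iff)
    have "Ck_on k (\<lambda>x. dd (\<lambda>w. inverse (f w)) x v) S" for v
    proof (rule Ck_on_cong[OF assms(1)])
      show "- dd f x v * (inverse (f x) * inverse (f x)) = dd (\<lambda>w. inverse (f w)) x v" if "x \<in> S" for x
        using frechet_derivative_eq[OF der[OF that]] by simp
      have "Ck_on k (\<lambda>x. - dd f x v) S"
        using smooth_on_minus[OF assms(1) smooth_on_dd[OF assms(2)]] by (simp add: smooth_on_def)
      then show "Ck_on k (\<lambda>x. - dd f x v * (inverse (f x) * inverse (f x))) S"
        using Ck_on_bilinear[OF assms(1) bounded_bilinear_mult]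
          Ck_on_bilinear[OF assms(1) bounded_bilinear_mult Suc.IH Suc.IH] by blast
    qed
    then show ?case
      using der by (auto simp: differentiable_def)
  qed
  then show ?thesis by (simp add: smooth_on_def)
qed

lemma smooth_on_vec:
  fixes f :: "'a::real_normed_vector \<Rightarrow> real ^ 'n::finite"
  assumes "open S" "\<And>i. smooth_on S (\<lambda>w. f w $ i)"
  shows "smooth_on S f"
proof -
  have "smooth_on S (\<lambda>w. \<Sum>i\<in>UNIV. (f w $ i) *\<^sub>R axis i 1)"
    by (intro smooth_on_sum smooth_on_scaleR smooth_on_const assms)
  moreover have "(\<Sum>i\<in>UNIV. (f w $ i) *\<^sub>R (axis i 1 :: real ^ 'n)) = f w" for w
    using basis_expansion[of "f w"] by (simp add: scalar_mult_eq_scaleR)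
  ultimately show ?thesis
    using smooth_on_cong[OF assms(1)] by blast
qed

lemma smooth_on_nth:
  "open S \<Longrightarrow> smooth_on S f \<Longrightarrow> smooth_on S (\<lambda>w. f w $ i)"
  by (rule smooth_on_bounded_linear_comp[OF _ bounded_linear_vec_nth])

lemma smooth_on_det:
  fixes A :: "'a::real_normed_vector \<Rightarrow> real ^ 'n::finite ^ 'n"
  assumes "open S" "\<And>i j. smooth_on S (\<lambda>w. A w $ i $ j)"
  shows "smooth_on S (\<lambda>w. det (A w))"
  unfolding det_def by (intro smooth_on_sum smooth_on_mult smooth_on_prod smooth_on_const assms)

text \<open>
  Cramer's rule makes the solution of a smooth family of regular linear systems a quotient of
  polynomials in the coefficients. The horizontal map and the Ricci operator are given by such
  systems, and this is the reason why they are smooth.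
\<close>

lemma smooth_on_solution_linear_system:
  fixes M :: "'a::real_normed_vector \<Rightarrow> real ^ 'n::finite \<Rightarrow> real ^ 'n"
  assumes S: "open S"
    and lin: "\<And>w. w \<in> S \<Longrightarrow> linear (M w)" and inj: "\<And>w. w \<in> S \<Longrightarrow> inj (M w)"
    and M: "\<And>z. smooth_on S (\<lambda>w. M w z)" and f: "smooth_on S f"
    and x: "\<And>w. w \<in> S \<Longrightarrow> M w (x w) = f w"
  shows "smooth_on S x"
proof -
  define A where "A w = matrix (M w)" for w
  have A: "smooth_on S (\<lambda>w. A w $ i $ j)" for i j
    unfolding A_def matrix_def using smooth_on_nth[OF S M] by simp
  have det0: "det (A w) \<noteq> 0" if "w \<in> S" for w
    using lin[OF that] inj[OF that] unfolding A_def
    by (simp add: det_nz_iff_inj)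
  have eq: "x w = (\<chi> k. det (\<chi> i j. if j = k then f w $ i else A w $ i $ j) / det (A w))" if "w \<in> S" for w
    using cramer[OF det0[OF that], of "x w" "f w"] x[OF that] lin[OF that]
    by (simp add: A_def)
  show ?thesis
  proof (rule smooth_on_cong[OF S _ eq[symmetric]])
    have "smooth_on S (\<lambda>w. if j = k then f w $ i else A w $ i $ j)" for i j k
      by (cases "j = k") (simp_all add: A smooth_on_nth[OF S f])
    then show "smooth_on S (\<lambda>w. \<chi> k. det (\<chi> i j. if j = k then f w $ i else A w $ i $ j) / det (A w))"
      by (intro smooth_on_vec S)
         (simp add: divide_inverse,
          intro smooth_on_mult smooth_on_inverse smooth_on_det A det0 S; simp)
  qed
qed

subsection \<open>Symmetry of second derivatives\<close>

text \<open>
  The double difference quotient of a function is, by the mean value theorem applied twice, a value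
  of either mixed derivative at a nearby point.
\<close>

lemma double_difference_eq_mixed_derivative:
  fixes f :: "'a::real_normed_vector \<Rightarrow> real"
  assumes t: "0 < t" and sub: "\<And>s r. 0 \<le> s \<Longrightarrow> s \<le> t \<Longrightarrow> 0 \<le> r \<Longrightarrow> r \<le> t \<Longrightarrow> x + s *\<^sub>R u + r *\<^sub>R v \<in> S"
    and f: "smooth_on S f"
  obtains s r where "0 < s" "s < t" "0 < r" "r < t"
    "f (x + t *\<^sub>R u + t *\<^sub>R v) - f (x + t *\<^sub>R u) - f (x + t *\<^sub>R v) + f x
      = t * t * dd (\<lambda>w. dd f w u) (x + s *\<^sub>R u + r *\<^sub>R v) v"
proof -
  define p where "p s r = x + s *\<^sub>R u + r *\<^sub>R v" for s r
  have p: "p s r \<in> S" if "0 \<le> s" "s \<le> t" "0 \<le> r" "r \<le> t" for s r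
    using sub that by (simp add: p_def)
  have lin: "linear (dd h w)" if "smooth_on S h" "w \<in> S" for h :: "'a \<Rightarrow> real" and w
    using smooth_on_differentiable[OF that] by (rule linear_frechet_derivative)
  have d1: "((\<lambda>s. h (p s r)) has_field_derivative dd h (p s r) u) (at s)"
    if "smooth_on S h" "p s r \<in> S" for h :: "'a \<Rightarrow> real" and s r
  proof -
    have "((\<lambda>s. p s r) has_derivative (\<lambda>k. k *\<^sub>R u)) (at s)"
      unfolding p_def by (auto intro!: derivative_eq_intros)
    from has_derivative_compose[OF this smooth_on_has_derivative[OF that]]
    show ?thesis
      by (rule has_derivative_imp_has_field_derivative)
         (simp add: linear_cmul[OF lin[OF that]])
  qed
  have d2: "((\<lambda>r. h (p s r)) has_field_derivative dd h (p s r) v) (at r)"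
    if "smooth_on S h" "p s r \<in> S" for h :: "'a \<Rightarrow> real" and s r
  proof -
    have "((\<lambda>r. p s r) has_derivative (\<lambda>k. k *\<^sub>R v)) (at r)"
      unfolding p_def by (auto intro!: derivative_eq_intros)
    from has_derivative_compose[OF this smooth_on_has_derivative[OF that]]
    show ?thesis
      by (rule has_derivative_imp_has_field_derivative)
         (simp add: linear_cmul[OF lin[OF that]])
  qed
  obtain s where s: "0 < s" "s < t"
    and es: "(f (p t t) - f (p t 0)) - (f (p 0 t) - f (p 0 0)) = (t - 0) * (dd f (p s t) u - dd f (p s 0) u)"
    using MVT2[OF t, of "\<lambda>s. f (p s t) - f (p s 0)" "\<lambda>s. dd f (p s t) u - dd f (p s 0) u"]
      DERIV_diff[OF d1[OF f p] d1[OF f p]] t by (auto simp: less_imp_le)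
  obtain r where r: "0 < r" "r < t"
    and er: "dd f (p s t) u - dd f (p s 0) u = (t - 0) * dd (\<lambda>w. dd f w u) (p s r) v"
    using MVT2[OF t, of "\<lambda>r. dd f (p s r) u" "\<lambda>r. dd (\<lambda>w. dd f w u) (p s r) v"]
      d2[OF smooth_on_dd[OF f] p] s by (auto simp: less_imp_le)
  show ?thesis
    by (rule that[OF s r]) (use es er in \<open>simp add: p_def\<close>)
qed

text \<open>
  Both mixed derivatives take the value of the same double difference quotient at points close to
  \<open>x\<close>, so by continuity they cannot differ at \<open>x\<close>.
\<close>

lemma dd_dd_commute_real:
  fixes f :: "'a::real_normed_vector \<Rightarrow> real"
  assumes "open S" "smooth_on S f" "x \<in> S"
  shows "dd (\<lambda>w. dd f w u) x v = dd (\<lambda>w. dd f w v) x u"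
proof (rule ccontr)
  let ?p = "\<lambda>w. dd (\<lambda>w. dd f w u) w v" and ?q = "\<lambda>w. dd (\<lambda>w. dd f w v) w u"
  assume ne: "?p x \<noteq> ?q x"
  define e where "e = \<bar>?p x - ?q x\<bar> / 2"
  have e: "e > 0" using ne by (simp add: e_def)
  have cont: "isCont ?p x" "isCont ?q x"
    using smooth_on_continuous[OF smooth_on_dd[OF smooth_on_dd[OF assms(2)]]] assms(1,3)
    by (auto simp: continuous_on_eq_continuous_at)
  then have "\<forall>\<^sub>F w in nhds x. \<bar>?p w - ?p x\<bar> < e" "\<forall>\<^sub>F w in nhds x. \<bar>?q w - ?q x\<bar> < e"
    using e unfolding isCont_def tendsto_iff dist_real_def eventually_nhds_conv_at by auto
  moreover have "\<forall>\<^sub>F w in nhds x. w \<in> S"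
    using assms(1,3) by (rule eventually_nhds_in_open)
  ultimately have "\<forall>\<^sub>F w in nhds x. \<bar>?p w - ?p x\<bar> < e \<and> \<bar>?q w - ?q x\<bar> < e \<and> w \<in> S"
    by (simp add: eventually_conj_iff)
  then obtain d where d: "d > 0"
    and close: "\<And>w. dist w x < d \<Longrightarrow> \<bar>?p w - ?p x\<bar> < e \<and> \<bar>?q w - ?q x\<bar> < e \<and> w \<in> S"
    unfolding eventually_nhds_metric by blast
  define t where "t = d / (norm u + norm v + 1)"
  have pos: "norm u + norm v + 1 > 0"
    by (smt (verit) norm_ge_zero)
  have t: "t > 0" using d pos by (simp add: t_def)
  have near: "dist (x + s *\<^sub>R u + r *\<^sub>R v) x < d" if "0 \<le> s" "s \<le> t" "0 \<le> r" "r \<le> t" for s r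
  proof -
    have "dist (x + s *\<^sub>R u + r *\<^sub>R v) x = norm (s *\<^sub>R u + r *\<^sub>R v)"
      by (simp add: dist_norm)
    also have "\<dots> \<le> s * norm u + r * norm v"
      using norm_triangle_ineq[of "s *\<^sub>R u" "r *\<^sub>R v"] that by simp
    also have "\<dots> \<le> t * norm u + t * norm v"
      using that by (intro add_mono mult_right_mono) auto
    also have "\<dots> < t * (norm u + norm v + 1)"
      using t by (simp add: algebra_simps)
    also have "\<dots> = d"
      using pos by (simp add: t_def)
    finally show ?thesis .
  qed
  obtain s r where "0 < s" "s < t" "0 < r" "r < t" and
    1: "f (x + t *\<^sub>R u + t *\<^sub>R v) - f (x + t *\<^sub>R u) - f (x + t *\<^sub>R v) + f x
      = t * t * ?p (x + s *\<^sub>R u + r *\<^sub>R v)"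
    by (rule double_difference_eq_mixed_derivative[OF t _ assms(2), of x u v])
       (use near close in auto)
  then have n1: "dist (x + s *\<^sub>R u + r *\<^sub>R v) x < d" using near by auto
  have near': "dist (x + s *\<^sub>R v + r *\<^sub>R u) x < d" if "0 \<le> s" "s \<le> t" "0 \<le> r" "r \<le> t" for s r
    using near[of r s] that by (simp add: algebra_simps)
  obtain s' r' where "0 < s'" "s' < t" "0 < r'" "r' < t" and
    2: "f (x + t *\<^sub>R v + t *\<^sub>R u) - f (x + t *\<^sub>R v) - f (x + t *\<^sub>R u) + f x
      = t * t * ?q (x + s' *\<^sub>R v + r' *\<^sub>R u)"
    by (rule double_difference_eq_mixed_derivative[OF t _ assms(2), of x v u])
       (use near' close in auto)
  then have n2: "dist (x + s' *\<^sub>R v + r' *\<^sub>R u) x < d" using near' by auto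
  have "t * t * ?p (x + s *\<^sub>R u + r *\<^sub>R v) = t * t * ?q (x + s' *\<^sub>R v + r' *\<^sub>R u)"
    using 1 2 by (simp add: algebra_simps)
  then have "?p (x + s *\<^sub>R u + r *\<^sub>R v) = ?q (x + s' *\<^sub>R v + r' *\<^sub>R u)"
    using t by simp
  then show False
    using close[OF n1] close[OF n2] e_def by (smt (verit) field_sum_of_halves)
qed

lemma dd_dd_commute:
  fixes f :: "'a::real_normed_vector \<Rightarrow> 'b::euclidean_space"
  assumes "open S" "smooth_on S f" "x \<in> S"
  shows "dd (\<lambda>w. dd f w u) x v = dd (\<lambda>w. dd f w v) x u"
proof (rule euclidean_eqI)
  fix b :: 'b
  have inner: "dd h w y \<bullet> b = dd (\<lambda>z. h z \<bullet> b) w y" if "smooth_on S h" "w \<in> S" for h w y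
    using frechet_derivative_eq[OF has_derivative_inner_left[OF smooth_on_has_derivative[OF that], of b]]
    by simp
  have second: "dd (\<lambda>w. dd f w y) x z \<bullet> b = dd (\<lambda>w. dd (\<lambda>z. f z \<bullet> b) w y) x z" for y z
  proof -
    have "dd (\<lambda>w. dd f w y) x z \<bullet> b = dd (\<lambda>w. dd f w y \<bullet> b) x z"
      using inner[OF smooth_on_dd[OF assms(2)] assms(3)] .
    also have "\<dots> = dd (\<lambda>w. dd (\<lambda>z. f z \<bullet> b) w y) x z"
      using frechet_derivative_cong_open[OF assms(1,3), of "\<lambda>w. dd f w y \<bullet> b" "\<lambda>w. dd (\<lambda>z. f z \<bullet> b) w y"]
        inner[OF assms(2)] by simp
    finally show ?thesis .
  qed
  have "smooth_on S (\<lambda>z. f z \<bullet> b)"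
    by (rule smooth_on_bounded_linear_comp[OF assms(1) bounded_linear_inner_left assms(2)])
  from dd_dd_commute_real[OF assms(1) this assms(3)]
  show "dd (\<lambda>w. dd f w u) x v \<bullet> b = dd (\<lambda>w. dd f w v) x u \<bullet> b"
    by (simp add: second)
qed

subsection \<open>Fields of linear and bilinear maps\<close>

lemma linear_expand_Basis:
  fixes f :: "'a::euclidean_space \<Rightarrow> 'b::real_vector"
  assumes "linear f"
  shows "f x = (\<Sum>i\<in>Basis. (x \<bullet> i) *\<^sub>R f i)"
proof -
  have "f x = f (\<Sum>i\<in>Basis. (x \<bullet> i) *\<^sub>R i)"
    by (simp add: euclidean_representation)
  then show ?thesis
    by (simp add: linear_sum[OF assms] linear_cmul[OF assms])
qed

lemma smooth_on_linear_field:
  fixes B :: "'w::real_normed_vector \<Rightarrow> 'a::euclidean_space \<Rightarrow> 'c::real_normed_vector"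
  assumes "open S" "\<And>u. u \<in> S \<Longrightarrow> linear (B u)" "\<And>i. smooth_on S (\<lambda>u. B u i)" "smooth_on S X"
  shows "smooth_on S (\<lambda>u. B u (X u))"
proof (rule smooth_on_cong[OF assms(1)])
  show "smooth_on S (\<lambda>u. \<Sum>i\<in>Basis. (X u \<bullet> i) *\<^sub>R B u i)"
    by (intro smooth_on_sum smooth_on_scaleR assms
        smooth_on_bounded_linear_comp[OF assms(1) bounded_linear_inner_left])
  show "\<And>u. u \<in> S \<Longrightarrow> (\<Sum>i\<in>Basis. (X u \<bullet> i) *\<^sub>R B u i) = B u (X u)"
    using linear_expand_Basis[OF assms(2)] by simp
qed

lemma smooth_on_bilinear_field:
  fixes B :: "'w::real_normed_vector \<Rightarrow> 'a::euclidean_space \<Rightarrow> 'b::euclidean_space \<Rightarrow> 'c::real_normed_vector"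
  assumes "open S" "\<And>u. u \<in> S \<Longrightarrow> bilinear (B u)" "\<And>i j. smooth_on S (\<lambda>u. B u i j)"
    and "smooth_on S X" "smooth_on S Z"
  shows "smooth_on S (\<lambda>u. B u (X u) (Z u))"
proof (rule smooth_on_linear_field[where B = "\<lambda>u. B u (X u)", OF assms(1) _ _ assms(5)])
  show "linear (B u (X u))" if "u \<in> S" for u
    using assms(2)[OF that] by (simp add: bilinear_def)
  show "smooth_on S (\<lambda>u. B u (X u) z)" for z
    by (rule smooth_on_linear_field[where B = "\<lambda>u a. B u a z", OF assms(1) _ _ assms(4)])
       (use assms(2,3) in \<open>auto simp: bilinear_def\<close>)
qed

lemma has_derivative_linear_field:
  fixes B :: "'w::real_normed_vector \<Rightarrow> 'a::euclidean_space \<Rightarrow> 'c::real_normed_vector"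
  assumes S: "open S" "w \<in> S" and lin: "\<And>u. u \<in> S \<Longrightarrow> linear (B u)"
    and B: "\<And>i. (\<lambda>u. B u i) differentiable (at w)"
    and X: "(X has_derivative X') (at w)"
  shows "((\<lambda>u. B u (X u)) has_derivative (\<lambda>v. dd (\<lambda>u. B u (X w)) w v + B w (X' v))) (at w)"
proof -
  have "((\<lambda>u. \<Sum>i\<in>Basis. (Y u \<bullet> i) *\<^sub>R B u i) has_derivative
      (\<lambda>v. \<Sum>i\<in>Basis. (Y w \<bullet> i) *\<^sub>R dd (\<lambda>u. B u i) w v + (Y' v \<bullet> i) *\<^sub>R B w i)) (at w)"
    if "(Y has_derivative Y') (at w)" for Y Y'
    using B by (intro has_derivative_sum has_derivative_scaleR has_derivative_inner_left that)
      (simp add: frechet_derivative_works)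
  then have der: "((\<lambda>u. B u (Y u)) has_derivative
      (\<lambda>v. (\<Sum>i\<in>Basis. (Y w \<bullet> i) *\<^sub>R dd (\<lambda>u. B u i) w v) + B w (Y' v))) (at w)"
    if "(Y has_derivative Y') (at w)" for Y Y'
    using that linear_expand_Basis[OF lin] S
    by (subst has_derivative_transform_within_open[OF _ S, where f = "\<lambda>u. \<Sum>i\<in>Basis. (Y u \<bullet> i) *\<^sub>R B u i"])
       (auto simp: sum.distrib)
  have lin_w: "B w 0 = 0" using lin[OF S(2)] by (rule linear_0)
  have "dd (\<lambda>u. B u (X w)) w = (\<lambda>v. \<Sum>i\<in>Basis. (X w \<bullet> i) *\<^sub>R dd (\<lambda>u. B u i) w v)"
    using frechet_derivative_eq[OF der[OF has_derivative_const[of "X w"]]] lin_w by simp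
  then show ?thesis
    using der[OF X] by simp
qed

lemma has_derivative_bilinear_field:
  fixes B :: "'w::real_normed_vector \<Rightarrow> 'a::euclidean_space \<Rightarrow> 'b::euclidean_space \<Rightarrow> 'c::real_normed_vector"
  assumes S: "open S" "w \<in> S" and lin: "\<And>u. u \<in> S \<Longrightarrow> bilinear (B u)"
    and B: "\<And>i j. (\<lambda>u. B u i j) differentiable (at w)"
    and X: "(X has_derivative X') (at w)" and Z: "(Z has_derivative Z') (at w)"
  shows "((\<lambda>u. B u (X u) (Z u)) has_derivative
    (\<lambda>v. dd (\<lambda>u. B u (X w) (Z w)) w v + B w (X' v) (Z w) + B w (X w) (Z' v))) (at w)"
proof -
  have l1: "linear (\<lambda>a. B u a z)" and l2: "linear (B u a)" if "u \<in> S" for u a z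
    using lin[OF that] by (auto simp: bilinear_def)
  have Bz: "(\<lambda>u. B u a z) differentiable (at w)" for a z
    using B by simp
  have XB: "((\<lambda>u. B u (X u) z) has_derivative (\<lambda>v. dd (\<lambda>u. B u (X w) z) w v + B w (X' v) z)) (at w)" for z
    by (rule has_derivative_linear_field[where B = "\<lambda>u a. B u a z", OF S l1 _ X]) (use Bz in auto)
  show ?thesis
    using has_derivative_linear_field[where B = "\<lambda>u. B u (X u)", OF S l2 _ Z] XB
      frechet_derivative_eq[OF XB[of "Z w"]]
    by (auto simp: differentiable_def)
qed

lemma linear_dd_field:
  fixes B :: "'w::real_normed_vector \<Rightarrow> 'a::real_normed_vector \<Rightarrow> 'c::real_normed_vector"
  assumes "open S" "w \<in> S" "\<And>u. u \<in> S \<Longrightarrow> linear (B u)" "\<And>i. (\<lambda>u. B u i) differentiable (at w)"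
  shows "linear (\<lambda>x. dd (\<lambda>u. B u x) w v)"
proof
  have d: "((\<lambda>u. B u i) has_derivative dd (\<lambda>u. B u i) w) (at w)" for i
    using assms(4) by (simp add: frechet_derivative_works)
  fix x y and r :: real
  have "((\<lambda>u. B u (x + y)) has_derivative (\<lambda>v. dd (\<lambda>u. B u x) w v + dd (\<lambda>u. B u y) w v)) (at w)"
    by (rule has_derivative_transform_within_open[OF has_derivative_add[OF d d] assms(1,2)])
       (simp add: linear_add[OF assms(3)])
  from frechet_derivative_eq[OF this]
  show "dd (\<lambda>u. B u (x + y)) w v = dd (\<lambda>u. B u x) w v + dd (\<lambda>u. B u y) w v" by simp
  have "((\<lambda>u. B u (r *\<^sub>R x)) has_derivative (\<lambda>v. r *\<^sub>R dd (\<lambda>u. B u x) w v)) (at w)"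
    by (rule has_derivative_transform_within_open[OF has_derivative_scaleR_right[OF d] assms(1,2)])
       (simp add: linear_cmul[OF assms(3)])
  from frechet_derivative_eq[OF this]
  show "dd (\<lambda>u. B u (r *\<^sub>R x)) w v = r *\<^sub>R dd (\<lambda>u. B u x) w v" by simp
qed


section \<open>Idempotents and their traces\<close>

lemma trace_matrix: "trace (matrix f) = (\<Sum>i\<in>UNIV. f (axis i 1) $ i)"
  by (simp add: trace_def matrix_def)

lemma trace_comp_commute:
  fixes f g :: "real ^ 'n::finite \<Rightarrow> real ^ 'n"
  assumes "linear f" "linear g"
  shows "trace (matrix (\<lambda>x. f (g x))) = trace (matrix (\<lambda>x. g (f x)))"
  using trace_mul_sym[of "matrix f" "matrix g"] matrix_compose[OF assms] matrix_compose[OF assms(2,1)]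
  by (simp add: o_def)

text \<open>
  For a basis \<open>B\<close> of the range, \<open>f\<close> is the sum of the rank-one maps \<open>x \<mapsto> \<phi>\<^sub>b(f x) b\<close> with
  \<open>\<phi>\<^sub>b\<close> the coordinate functions; each of them has the trace \<open>\<phi>\<^sub>b(f b) = \<phi>\<^sub>b(b) = 1\<close>.
\<close>

lemma trace_idempotent:
  fixes f :: "real ^ 'n::finite \<Rightarrow> real ^ 'n"
  assumes lin: "linear f" and idem: "\<And>x. f (f x) = f x"
  shows "trace (matrix f) = dim (range f)"
proof -
  obtain B where B: "B \<subseteq> range f" "independent B" "range f \<subseteq> span B" "card B = dim (range f)"
    by (rule basis_exists)
  have fin: "finite B"
    using B(2) by (rule independent_imp_finite)
  have sp: "x \<in> range f \<Longrightarrow> x \<in> span B" for x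
    using B(3) by blast
  define \<phi> where "\<phi> b x = representation B (f x) b" for b x
  have expand: "f x = (\<Sum>b\<in>B. \<phi> b x *\<^sub>R b)" for x
    using sum_representation_eq[OF B(2) sp fin subset_refl, of "f x"] by (simp add: \<phi>_def)
  have lin_\<phi>: "linear (\<phi> b)" for b
  proof
    show "\<phi> b (x + y) = \<phi> b x + \<phi> b y" for x y
      using representation_add[OF B(2) sp sp, of "f y" "f x"] by (simp add: \<phi>_def linear_add[OF lin])
    show "\<phi> b (r *\<^sub>R x) = r *\<^sub>R \<phi> b x" for r x
      using representation_scale[OF B(2) sp, of "f x"] by (simp add: \<phi>_def linear_cmul[OF lin])
  qed
  have "trace (matrix f) = (\<Sum>i\<in>UNIV. \<Sum>b\<in>B. \<phi> b (axis i 1) * b $ i)"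
    by (subst trace_matrix, subst expand) simp
  also have "\<dots> = (\<Sum>b\<in>B. \<Sum>i\<in>UNIV. \<phi> b (axis i 1) * b $ i)"
    by (rule sum.swap)
  also have "\<dots> = (\<Sum>b\<in>B. \<phi> b b)"
  proof (rule sum.cong[OF refl])
    fix b
    have "\<phi> b b = \<phi> b (\<Sum>i\<in>UNIV. (b $ i) *\<^sub>R axis i 1)"
      using basis_expansion[of b] by (simp add: scalar_mult_eq_scaleR)
    then show "(\<Sum>i\<in>UNIV. \<phi> b (axis i 1) * b $ i) = \<phi> b b"
      by (simp add: linear_sum[OF lin_\<phi>] linear_cmul[OF lin_\<phi>] mult.commute)
  qed
  also have "\<dots> = (\<Sum>b\<in>B. 1)"
  proof (rule sum.cong[OF refl])
    fix b assume b: "b \<in> B"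
    then have "f b = b"
      using B(1) idem by auto
    then show "\<phi> b b = 1"
      using representation_basis[OF B(2) b] by (simp add: \<phi>_def)
  qed
  finally show ?thesis
    using B(4) by simp
qed

lemma trace_scaled_idempotent:
  fixes f :: "real ^ 'n::finite \<Rightarrow> real ^ 'n"
  assumes lin: "linear f" and f: "\<And>x. f (f x) = \<alpha> *\<^sub>R f x" and "\<alpha> \<noteq> 0"
  shows "trace (matrix f) / \<alpha> = dim (range f)"
proof -
  let ?p = "\<lambda>x. f x /\<^sub>R \<alpha>"
  have lin_p: "linear ?p"
    using lin by (simp add: linear_compose_scale_right)
  have idem: "?p (?p x) = ?p x" for x
    by (simp add: linear_cmul[OF lin] f assms(3))
  have "range ?p = range f"
  proof
    show "range ?p \<subseteq> range f"
      using linear_cmul[OF lin] by (metis image_subsetI rangeI)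
    show "range f \<subseteq> range ?p"
    proof (rule image_subsetI)
      show "f x \<in> range ?p" for x
        using assms(3) by (intro range_eqI[of _ _ "\<alpha> *\<^sub>R x"]) (simp add: linear_cmul[OF lin])
    qed
  qed
  moreover have "trace (matrix ?p) = trace (matrix f) / \<alpha>"
    by (simp add: trace_matrix sum_divide_distrib divide_inverse sum_distrib_left mult.commute)
  ultimately show ?thesis
    using trace_idempotent[OF lin_p idem] by simp
qed

lemma eigenvalues_scaled_idempotent:
  fixes f :: "'a::euclidean_space \<Rightarrow> 'a"
  assumes lin: "linear f" and f: "\<And>x. f (f x) = \<alpha> *\<^sub>R f x" and nz: "f a \<noteq> 0"
  shows "eigenvalues f = (if \<forall>v. f v = \<alpha> *\<^sub>R v then {\<alpha>} else {0, \<alpha>})"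
proof -
  have upper: "l \<in> {0, \<alpha>}" if l: "l \<in> eigenvalues f" for l
  proof -
    obtain v where v: "v \<noteq> 0" "f v = l *\<^sub>R v"
      using l by (auto simp: eigenvalues_def)
    have "(l * l - \<alpha> * l) *\<^sub>R v = 0"
      using f[of v] v(2) by (simp add: linear_cmul[OF lin] algebra_simps)
    then show ?thesis
      using v(1) by (auto simp: algebra_simps)
  qed
  have \<alpha>: "\<alpha> \<in> eigenvalues f"
    using f nz by (auto simp: eigenvalues_def)
  show ?thesis
  proof (cases "\<forall>v. f v = \<alpha> *\<^sub>R v")
    case True
    have "l = \<alpha>" if "l \<in> eigenvalues f" for l
      using that True by (auto simp: eigenvalues_def)
    then have "eigenvalues f = {\<alpha>}"
      using \<alpha> by blast
    then show ?thesis
      using True by simp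
  next
    case False
    then obtain v where v: "f v - \<alpha> *\<^sub>R v \<noteq> 0" by auto
    have "f (f v - \<alpha> *\<^sub>R v) = 0 *\<^sub>R (f v - \<alpha> *\<^sub>R v)"
      by (simp add: linear_diff[OF lin] linear_cmul[OF lin] f)
    then have "0 \<in> eigenvalues f"
      using v unfolding eigenvalues_def by blast
    then have "eigenvalues f = {0, \<alpha>}"
      using \<alpha> upper by blast
    then show ?thesis
      using False by (simp only: if_False)
  qed
qed


section \<open>A regular connection in a chart\<close>

text \<open>
  The classical coordinate formula for the curvature tensor; unlike \<^const>\<open>curvature\<close>, which acts on
  fields, it is visibly a function of the values of its arguments at a point.
\<close>

definition coefficient_curvature ::
  "'n::finite conn \<Rightarrow> 'n tcoord \<Rightarrow> 'n tcoord \<Rightarrow> 'n tcoord \<Rightarrow> real ^ 'n \<Rightarrow> real ^ 'n" where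
  "coefficient_curvature G w \<xi> \<zeta> z =
     - dd (\<lambda>u. G u \<zeta> z) w \<xi> + dd (\<lambda>u. G u \<xi> z) w \<zeta> - G w \<xi> (G w \<zeta> z) + G w \<zeta> (G w \<xi> z)"

abbreviation hlift :: "'n::finite conn \<Rightarrow> 'n tcoord \<Rightarrow> real ^ 'n \<Rightarrow> 'n tcoord" where
  "hlift G w a \<equiv> beta G (\<lambda>_. a) w"

locale regular_connection_on =
  fixes S :: "'n::finite tcoord set" and G :: "'n conn"
  assumes open_S: "open S"
    and bilinear_G: "w \<in> S \<Longrightarrow> bilinear (G w)"
    and smooth_G: "smooth_on S (\<lambda>w. G w \<xi> z)"
    and regular: "regular_connection S G"
begin

lemma linear_G1: "w \<in> S \<Longrightarrow> linear (\<lambda>\<xi>. G w \<xi> z)"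
  and linear_G2: "w \<in> S \<Longrightarrow> linear (G w \<xi>)"
  using bilinear_G unfolding bilinear_def by blast+

lemma smooth_G_field: "smooth_on S X \<Longrightarrow> smooth_on S Z \<Longrightarrow> smooth_on S (\<lambda>w. G w (X w) (Z w))"
  by (rule smooth_on_bilinear_field[OF open_S bilinear_G smooth_G])

lemma smooth_dd_field:
  fixes Z :: "'n tcoord \<Rightarrow> 'b::euclidean_space"
  assumes "smooth_on S X" "smooth_on S Z" shows "smooth_on S (\<lambda>w. dd Z w (X w))"
  by (rule smooth_on_linear_field[OF open_S _ smooth_on_dd[OF assms(2)] assms(1)])
     (rule linear_frechet_derivative[OF smooth_on_differentiable[OF assms(2)]])

lemma smooth_cov: "smooth_on S X \<Longrightarrow> smooth_on S Z \<Longrightarrow> smooth_on S (cov G X Z)"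
  unfolding cov_def by (intro smooth_on_add open_S smooth_dd_field smooth_G_field)

lemma dd_cov:
  assumes "smooth_on S Y" "smooth_on S Z" "w \<in> S"
  shows "dd (cov G Y Z) w v = dd (\<lambda>u. dd Z u (Y w)) w v + dd Z w (dd Y w v)
    + dd (\<lambda>u. G u (Y w) (Z w)) w v + G w (dd Y w v) (Z w) + G w (Y w) (dd Z w v)"
proof -
  have Y: "(Y has_derivative dd Y w) (at w)" and Z: "(Z has_derivative dd Z w) (at w)"
    using assms by (auto intro: smooth_on_has_derivative)
  have 1: "((\<lambda>u. dd Z u (Y u)) has_derivative
      (\<lambda>v. dd (\<lambda>u. dd Z u (Y w)) w v + dd Z w (dd Y w v))) (at w)"
    by (rule has_derivative_linear_field[OF open_S assms(3) _ _ Y])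
       (use assms in \<open>auto intro!: linear_frechet_derivative smooth_on_differentiable[of S] smooth_on_dd\<close>)
  have 2: "((\<lambda>u. G u (Y u) (Z u)) has_derivative
      (\<lambda>v. dd (\<lambda>u. G u (Y w) (Z w)) w v + G w (dd Y w v) (Z w) + G w (Y w) (dd Z w v))) (at w)"
    by (rule has_derivative_bilinear_field[OF open_S assms(3) bilinear_G _ Y Z])
       (use assms smooth_G in \<open>auto intro!: smooth_on_differentiable[of S]\<close>)
  show ?thesis
    using frechet_derivative_eq[OF has_derivative_add[OF 1 2]] by (simp add: cov_def)
qed

text \<open>
  The second derivatives of \<open>Z\<close> cancel by symmetry and the derivatives of \<open>X\<close> and \<open>Y\<close> are absorbed by
  the bracket: this is the tensoriality of the curvature.
\<close>

lemma curvature_eq: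
  assumes X: "smooth_on S X" and Y: "smooth_on S Y" and Z: "smooth_on S Z" and w: "w \<in> S"
  shows "curvature G X Y Z w = coefficient_curvature G w (X w) (Y w) (Z w)"
proof -
  have lin: "linear (dd Z w)"
    using Z w by (intro linear_frechet_derivative smooth_on_differentiable)
  have sym: "dd (\<lambda>u. dd Z u (Y w)) w (X w) = dd (\<lambda>u. dd Z u (X w)) w (Y w)"
    by (rule dd_dd_commute[OF open_S Z w])
  have cov_at: "cov G V Z w = dd Z w (V w) + G w (V w) (Z w)" for V
    by (simp add: cov_def)
  have 1: "cov G X (cov G Y Z) w = dd (\<lambda>u. dd Z u (Y w)) w (X w) + dd Z w (dd Y w (X w))
    + dd (\<lambda>u. G u (Y w) (Z w)) w (X w) + G w (dd Y w (X w)) (Z w) + G w (Y w) (dd Z w (X w))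
    + (G w (X w) (dd Z w (Y w)) + G w (X w) (G w (Y w) (Z w)))"
    by (simp only: cov_def[of G X "cov G Y Z"] dd_cov[OF Y Z w] cov_at[of Y] linear_add[OF linear_G2[OF w]])
  have 2: "cov G Y (cov G X Z) w = dd (\<lambda>u. dd Z u (X w)) w (Y w) + dd Z w (dd X w (Y w))
    + dd (\<lambda>u. G u (X w) (Z w)) w (Y w) + G w (dd X w (Y w)) (Z w) + G w (X w) (dd Z w (Y w))
    + (G w (Y w) (dd Z w (X w)) + G w (Y w) (G w (X w) (Z w)))"
    by (simp only: cov_def[of G Y "cov G X Z"] dd_cov[OF X Z w] cov_at[of X] linear_add[OF linear_G2[OF w]])
  have 3: "cov G (bracket X Y) Z w = dd Z w (dd Y w (X w)) - dd Z w (dd X w (Y w))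
    + (G w (dd Y w (X w)) (Z w) - G w (dd X w (Y w)) (Z w))"
    by (simp add: cov_def bracket_def linear_diff[OF lin] linear_diff[OF linear_G1[OF w]])
  show ?thesis
    by (simp add: curvature_def coefficient_curvature_def 1 2 3 sym)
qed

lemma linear_dd_G1: "w \<in> S \<Longrightarrow> linear (\<lambda>\<xi>. dd (\<lambda>u. G u \<xi> z) w v)"
  by (rule linear_dd_field[where B = "\<lambda>u \<xi>. G u \<xi> z", OF open_S _ linear_G1 smooth_on_differentiable[OF smooth_G]])

lemma linear_dd_G2: "w \<in> S \<Longrightarrow> linear (\<lambda>z. dd (\<lambda>u. G u \<xi> z) w v)"
  by (rule linear_dd_field[where B = "\<lambda>u. G u \<xi>", OF open_S _ linear_G2 smooth_on_differentiable[OF smooth_G]])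

lemma linear_dd_G3: "w \<in> S \<Longrightarrow> linear (\<lambda>v. dd (\<lambda>u. G u \<xi> z) w v)"
  by (rule linear_frechet_derivative[OF smooth_on_differentiable[OF smooth_G]])

lemma coefficient_curvature_linear:
  assumes "w \<in> S"
  shows "linear (\<lambda>\<xi>. coefficient_curvature G w \<xi> \<zeta> z)"
    and "linear (\<lambda>\<zeta>. coefficient_curvature G w \<xi> \<zeta> z)"
    and "linear (\<lambda>z. coefficient_curvature G w \<xi> \<zeta> z)"
  unfolding coefficient_curvature_def
  using assms
  by (intro linear_compose_add linear_compose_sub linear_compose_neg linear_dd_G1 linear_dd_G2
      linear_dd_G3 linear_G1 linear_G2 linear_compose[OF linear_G1 linear_G2, unfolded o_def]
      linear_compose[OF linear_G2 linear_G2, unfolded o_def]; assumption)+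

subsection \<open>Horizontal lifts\<close>

lemma horizontal_space_iff: "\<xi> \<in> horizontal_space G w \<longleftrightarrow> snd \<xi> + G w \<xi> (snd w) = 0"
proof -
  have eta: "(eta :: 'n tcoord \<Rightarrow> real ^ 'n) = snd"
    by (simp add: fun_eq_iff eta_def)
  have "(snd has_derivative snd) (at w)"
    by (auto intro!: derivative_eq_intros)
  from frechet_derivative_eq[OF this] show ?thesis
    by (simp add: horizontal_space_def cov_def eta)
qed

lemma horizontal_vertical_eq_0:
  assumes "w \<in> S" "fst \<xi> = 0" "snd \<xi> + G w \<xi> (snd w) = 0"
  shows "\<xi> = 0"
  using assms regular horizontal_space_iff
  unfolding regular_connection_def vertical_space_def by blast

lemma hlift_unique:
  assumes w: "w \<in> S" and \<xi>: "snd \<xi> + G w \<xi> (snd w) = 0"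
  shows "hlift G w (fst \<xi>) = \<xi>"
proof -
  have inj: "inj_on fst (horizontal_space G w)"
  proof (rule inj_onI)
    fix p q assume p: "p \<in> horizontal_space G w" and q: "q \<in> horizontal_space G w" and "fst p = fst q"
    have "p - q = 0"
    proof (rule horizontal_vertical_eq_0[OF w])
      show "fst (p - q) = 0" using \<open>fst p = fst q\<close> by simp
      have "snd (p - q) + G w (p - q) (snd w) = (snd p + G w p (snd w)) - (snd q + G w q (snd w))"
        by (simp add: linear_diff[OF linear_G1[OF w]])
      then show "snd (p - q) + G w (p - q) (snd w) = 0"
        by (simp only: p[unfolded horizontal_space_iff] q[unfolded horizontal_space_iff] diff_self)
    qed
    then show "p = q" by simp
  qed
  then show ?thesis
    unfolding beta_def using \<xi> by (intro inv_into_f_eq) (auto simp: horizontal_space_iff)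
qed

lemma
  assumes w: "w \<in> S"
  shows fst_hlift: "fst (hlift G w a) = a"
    and hlift_horizontal: "snd (hlift G w a) + G w (hlift G w a) (snd w) = 0"
proof -
  have "\<exists>v \<in> vertical_space. \<exists>h \<in> horizontal_space G w. (a, 0) = v + h"
    using regular w by (auto simp: regular_connection_def)
  then obtain h where h: "h \<in> horizontal_space G w" "fst h = a"
    by (auto simp: vertical_space_def)
  then have "hlift G w a = h"
    using hlift_unique[OF w, of h] by (simp add: horizontal_space_iff)
  then show "fst (hlift G w a) = a" "snd (hlift G w a) + G w (hlift G w a) (snd w) = 0"
    using h by (simp_all add: horizontal_space_iff)
qed

lemma linear_hlift:
  assumes w: "w \<in> S" shows "linear (hlift G w)"
proof
  fix a b and r :: real
  have "snd (hlift G w a + hlift G w b) + G w (hlift G w a + hlift G w b) (snd w)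
      = (snd (hlift G w a) + G w (hlift G w a) (snd w)) + (snd (hlift G w b) + G w (hlift G w b) (snd w))"
    by (simp add: linear_add[OF linear_G1[OF w]])
  then have sum: "snd (hlift G w a + hlift G w b) + G w (hlift G w a + hlift G w b) (snd w) = 0"
    by (simp only: hlift_horizontal[OF w] add_0)
  show "hlift G w (a + b) = hlift G w a + hlift G w b"
    using hlift_unique[OF w, of "hlift G w a + hlift G w b"] sum by (simp add: fst_hlift[OF w])
  have "snd (r *\<^sub>R hlift G w a) + G w (r *\<^sub>R hlift G w a) (snd w)
      = r *\<^sub>R (snd (hlift G w a) + G w (hlift G w a) (snd w))"
    by (simp add: linear_cmul[OF linear_G1[OF w]] scaleR_add_right)
  then show "hlift G w (r *\<^sub>R a) = r *\<^sub>R hlift G w a"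
    using hlift_unique[OF w, of "r *\<^sub>R hlift G w a"] hlift_horizontal[OF w, of a]
    by (simp add: fst_hlift[OF w])
qed

text \<open>
  The vertical part \<open>b\<close> of the lift of \<open>a\<close> solves the linear system \<open>b + G(0, b) y = - G(a, 0) y\<close>,
  whose regularity is the regularity of the connection.
\<close>

lemma smooth_hlift: "smooth_on S (\<lambda>w. hlift G w a)"
proof -
  define M where "M w b = b + G w (0, b) (snd w)" for w and b :: "real ^ 'n"
  have snd: "smooth_on S (snd :: 'n tcoord \<Rightarrow> real ^ 'n)"
    by (rule smooth_on_linear[OF open_S bounded_linear_snd])
  have lin0: "linear (\<lambda>b. G w (0, b) (snd w))" if "w \<in> S" for w
    using linear_compose[OF _ linear_G1[OF that], of "\<lambda>b. (0, b)"] 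
    by (simp add: o_def linear_iff)
  have "smooth_on S (\<lambda>w. snd (hlift G w a))"
  proof (rule smooth_on_solution_linear_system[OF open_S])
    show lin: "linear (M w)" if "w \<in> S" for w
      unfolding M_def by (intro linear_compose_add linear_id[unfolded id_def] lin0 that)
    show "inj (M w)" if w: "w \<in> S" for w
      unfolding linear_injective_0[OF lin[OF w]]
    proof (intro allI impI)
      fix b assume "M w b = 0"
      then have "(0, b) = (0 :: 'n tcoord)"
        by (intro horizontal_vertical_eq_0[OF w]) (simp_all add: M_def)
      then show "b = 0" by (simp add: zero_prod_def)
    qed
    show "smooth_on S (\<lambda>w. M w z)" for z
      unfolding M_def by (intro smooth_on_add open_S smooth_on_const smooth_G_field snd)
    show "smooth_on S (\<lambda>w. - G w (a, 0) (snd w))"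
      by (intro smooth_on_minus open_S smooth_on_const smooth_G_field snd)
    show "M w (snd (hlift G w a)) = - G w (a, 0) (snd w)" if w: "w \<in> S" for w
    proof -
      have "G w (hlift G w a) (snd w) = G w ((a, 0) + (0, snd (hlift G w a))) (snd w)"
        using fst_hlift[OF w, of a] by (metis add_0 add.right_neutral add_Pair prod.collapse)
      then show ?thesis
        using hlift_horizontal[OF w, of a]
        by (simp only: M_def linear_add[OF linear_G1[OF w]] eq_neg_iff_add_eq_0 add_ac)
    qed
  qed
  then have "smooth_on S (\<lambda>w. (a, snd (hlift G w a)))"
    by (intro smooth_on_Pair open_S smooth_on_const)
  then show ?thesis
    by (rule smooth_on_cong[OF open_S]) (simp add: fst_hlift prod_eq_iff)
qed

subsection \<open>The horizontal curvature and its trace\<close>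

lemma h_curvature_eq:
  "w \<in> S \<Longrightarrow> h_curvature G w a b z = coefficient_curvature G w (hlift G w a) (hlift G w b) z"
  unfolding h_curvature_def by (rule curvature_eq[OF smooth_hlift smooth_hlift smooth_on_const])

lemma h_curvature_linear:
  assumes "w \<in> S"
  shows "linear (\<lambda>a. h_curvature G w a b z)"
    and "linear (\<lambda>b. h_curvature G w a b z)"
    and "linear (\<lambda>z. h_curvature G w a b z)"
  using linear_compose[OF linear_hlift coefficient_curvature_linear(1)]
    linear_compose[OF linear_hlift coefficient_curvature_linear(2)]
    coefficient_curvature_linear(3) assms
  by (simp_all add: o_def h_curvature_eq)

lemma h_curvature_skew: "w \<in> S \<Longrightarrow> h_curvature G w b a z = - h_curvature G w a b z"
  by (simp add: h_curvature_eq coefficient_curvature_def)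

lemma smooth_h_curvature: "smooth_on S (\<lambda>w. h_curvature G w a b z)"
proof -
  have br: "smooth_on S (bracket X Y)" if "smooth_on S X" "smooth_on S Y" for X Y
    unfolding bracket_def by (intro smooth_on_diff open_S smooth_dd_field that)
  show ?thesis
    unfolding h_curvature_def curvature_def
    by (intro smooth_on_add smooth_on_minus open_S smooth_cov smooth_hlift smooth_on_const br)
qed

lemma Ric_eq: "Ric G w a b = (\<Sum>i\<in>UNIV. h_curvature G w a (axis i 1) b $ i)"
  by (simp add: Ric_def trace_matrix)

lemma bilinear_Ric:
  assumes "w \<in> S" shows "bilinear (Ric G w)"
  using h_curvature_linear[OF assms]
  by (auto simp: bilinear_def linear_iff Ric_eq sum.distrib sum_distrib_left)

lemma smooth_Ric: "smooth_on S (\<lambda>w. Ric G w a b)"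
  unfolding Ric_eq by (intro smooth_on_sum smooth_on_nth open_S smooth_h_curvature)

end

section \<open>The Finsler metric and the Ricci operator in a chart\<close>

lemma axis_extensionality:
  fixes f h :: "real ^ 'm::finite \<Rightarrow> 'b::real_vector"
  assumes "linear f" "linear h" "\<And>j. f (axis j 1) = h (axis j 1)"
  shows "f = h"
  by (rule linear_eq_stdbasis[OF assms(1,2)]) (use assms(3) in \<open>auto simp: Basis_vec_def\<close>)

lemma dd_Pair:
  fixes f :: "'a::real_normed_vector \<times> 'b::real_normed_vector \<Rightarrow> 'c::real_normed_vector"
  assumes "f differentiable (at (x, y))"
  shows "dd (\<lambda>z. f (x, z)) y a = dd f (x, y) (0, a)"
proof -
  have "((\<lambda>z. (x, z)) has_derivative (\<lambda>a. (0, a))) (at y)"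
    by (auto intro!: derivative_eq_intros)
  from has_derivative_compose[OF this, of f "dd f (x, y)"] show ?thesis
    using assms frechet_derivative_works frechet_derivative_eq by force
qed

text \<open>
  As an iterated derivative in vertical directions on the slit bundle, the metric inherits smoothness
  and symmetry from the general facts on such derivatives.
\<close>

lemma finsler_metric_eq:
  assumes S: "open S" and L: "smooth_on S L" and w: "w \<in> S"
  shows "finsler_metric L w a b = dd (\<lambda>u. dd (\<lambda>v. (L v)\<^sup>2) u (0, a)) w (0, b) / 2"
proof -
  have L2: "smooth_on S (\<lambda>v. (L v)\<^sup>2)"
    unfolding power2_eq_square by (rule smooth_on_mult[OF S L L])
  have sl: "open ((\<lambda>z. (fst w, z)) -` S)"
    by (intro open_vimage S continuous_intros)
  have "frechet_derivative (\<lambda>y. frechet_derivative (\<lambda>z. (L (fst w, z))\<^sup>2) (at y) a) (at (snd w))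
      = frechet_derivative (\<lambda>y. dd (\<lambda>v. (L v)\<^sup>2) (fst w, y) (0, a)) (at (snd w))"
    by (rule frechet_derivative_cong_open[OF sl]) (use w L2 in \<open>auto intro!: dd_Pair smooth_on_differentiable\<close>)
  moreover have "dd (\<lambda>y. dd (\<lambda>v. (L v)\<^sup>2) (fst w, y) (0, a)) (snd w) b
      = dd (\<lambda>u. dd (\<lambda>v. (L v)\<^sup>2) u (0, a)) (fst w, snd w) (0, b)"
    by (rule dd_Pair) (use w in \<open>auto intro!: smooth_on_differentiable[OF smooth_on_dd[OF L2]]\<close>)
  ultimately show ?thesis
    by (simp add: finsler_metric_def)
qed

locale finsler_connection_on = regular_connection_on S G
  for S :: "'n::finite tcoord set" and G :: "'n conn" +
  fixes L :: "'n tcoord \<Rightarrow> real"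
  assumes smooth_L: "smooth_on S L"
    and pos: "w \<in> S \<Longrightarrow> a \<noteq> 0 \<Longrightarrow> finsler_metric L w a a > 0"
begin

abbreviation g :: "'n tcoord \<Rightarrow> real ^ 'n \<Rightarrow> real ^ 'n \<Rightarrow> real" where "g \<equiv> finsler_metric L"

lemma smooth_L2: "smooth_on S (\<lambda>v. (L v)\<^sup>2)"
  unfolding power2_eq_square by (rule smooth_on_mult[OF open_S smooth_L smooth_L])

lemma smooth_g: "smooth_on S (\<lambda>w. g w a b)"
proof (rule smooth_on_cong[OF open_S])
  show "smooth_on S (\<lambda>w. dd (\<lambda>u. dd (\<lambda>v. (L v)\<^sup>2) u (0, a)) w (0, b) * (1 / 2))"
    by (intro smooth_on_mult smooth_on_const open_S smooth_on_dd smooth_L2)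
qed (simp add: finsler_metric_eq[OF open_S smooth_L])

lemma g_sym: "w \<in> S \<Longrightarrow> g w a b = g w b a"
  by (simp add: finsler_metric_eq[OF open_S smooth_L] dd_dd_commute[OF open_S smooth_L2])

lemma bilinear_g:
  assumes w: "w \<in> S" shows "bilinear (g w)"
proof -
  have "linear (g w a)" for a
  proof -
    have "linear (dd (\<lambda>u. dd (\<lambda>v. (L v)\<^sup>2) u (0, a)) w)"
      by (intro linear_frechet_derivative smooth_on_differentiable[OF smooth_on_dd[OF smooth_L2]] w)
    from linear_compose[OF _ this, of "\<lambda>b. (0, b)"]
    have "linear (\<lambda>b. dd (\<lambda>u. dd (\<lambda>v. (L v)\<^sup>2) u (0, a)) w (0, b))"
      by (simp add: o_def linear_iff)
    then show ?thesis
      unfolding finsler_metric_eq[OF open_S smooth_L w, abs_def]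
      using linear_compose_scale_right[of _ "1 / 2"] by (simp add: linear_iff field_simps)
  qed
  then show ?thesis
    using g_sym[OF w] by (simp add: bilinear_def)
qed

lemma linear_g1: "w \<in> S \<Longrightarrow> linear (\<lambda>a. g w a b)"
  and linear_g2: "w \<in> S \<Longrightarrow> linear (g w a)"
  using bilinear_g by (auto simp: bilinear_def)

lemma g_nondegenerate:
  assumes w: "w \<in> S" and "\<And>b. g w u b = g w v b" shows "u = v"
proof (rule ccontr)
  assume "u \<noteq> v"
  then have "g w (u - v) (u - v) > 0"
    using pos[OF w] by simp
  moreover have "g w (u - v) (u - v) = 0"
    using assms(2)[of "u - v"] by (simp add: linear_diff[OF linear_g1[OF w]])
  ultimately show False by simp
qed

text \<open>The musical isomorphism, with covectors written as vectors of components.\<close>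

definition flat :: "'n tcoord \<Rightarrow> real ^ 'n \<Rightarrow> real ^ 'n" where
  "flat w v = (\<chi> j. g w v (axis j 1))"

lemma linear_flat: "w \<in> S \<Longrightarrow> linear (flat w)"
  using linear_g1 by (simp add: flat_def linear_iff vec_eq_iff)

lemma inj_flat:
  assumes w: "w \<in> S" shows "inj (flat w)"
proof (rule injI)
  fix u v assume "flat w u = flat w v"
  then have "g w u = g w v"
    by (intro axis_extensionality linear_g2 w) (simp add: flat_def vec_eq_iff)
  then show "u = v"
    using g_nondegenerate[OF w] by simp
qed

lemma riesz:
  assumes w: "w \<in> S" and l: "linear l"
  shows "\<exists>!v. \<forall>b. g w v b = l b"
proof (rule ex_ex1I)
  have "surj (flat w)"
    using linear_inj_imp_surj[OF linear_flat inj_flat] w by blast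
  then obtain v where v: "flat w v = (\<chi> j. l (axis j 1))"
    by (metis surjD)
  have "g w v = l"
    by (rule axis_extensionality[OF linear_g2[OF w] l]) (use v in \<open>simp add: flat_def vec_eq_iff\<close>)
  then show "\<exists>v. \<forall>b. g w v b = l b" by auto
  show "u = v" if "\<forall>b. g w u b = l b" "\<forall>b. g w v b = l b" for u v
    using that g_nondegenerate[OF w] by simp
qed

lemma g_Ric_o:
  assumes w: "w \<in> S" shows "g w (Ric_o L G w a) b = Ric G w a b"
proof -
  have "linear (Ric G w a)"
    using bilinear_Ric[OF w] by (simp add: bilinear_def)
  from theI'[OF riesz[OF w this]] show ?thesis
    by (simp add: Ric_o_def)
qed

lemma linear_Ric_o:
  assumes w: "w \<in> S" shows "linear (Ric_o L G w)"
proof -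
  have R: "linear (\<lambda>a. Ric G w a b)" for b
    using bilinear_Ric[OF w] by (simp add: bilinear_def)
  show ?thesis
    by (intro linearI g_nondegenerate[OF w])
      (simp_all add: g_Ric_o[OF w] linear_add[OF linear_g1[OF w]] linear_cmul[OF linear_g1[OF w]]
        linear_add[OF R] linear_cmul[OF R])
qed

lemma smooth_Ric_o: "smooth_on S (\<lambda>w. Ric_o L G w a)"
proof (rule smooth_on_solution_linear_system[OF open_S linear_flat inj_flat])
  show "smooth_on S (\<lambda>w. flat w z)" for z
    by (rule smooth_on_vec[OF open_S]) (simp add: flat_def smooth_g)
  show "smooth_on S (\<lambda>w. \<chi> j. Ric G w a (axis j 1))"
    by (rule smooth_on_vec[OF open_S]) (simp add: smooth_Ric)
  show "flat w (Ric_o L G w a) = (\<chi> j. Ric G w a (axis j 1))" if "w \<in> S" for w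
    by (simp add: flat_def g_Ric_o[OF that])
qed

lemma continuous_h_scalar: "continuous_on S (h_scalar L G)"
proof -
  have "smooth_on S (\<lambda>w. \<Sum>i\<in>UNIV. Ric_o L G w (axis i 1) $ i)"
    by (intro smooth_on_sum smooth_on_nth open_S smooth_Ric_o)
  then show ?thesis
    using smooth_on_continuous by (simp add: h_scalar_def[abs_def] trace_matrix)
qed

lemma Ric_o_eq_0_iff: "w \<in> S \<Longrightarrow> Ric_o L G w a = 0 \<longleftrightarrow> (\<forall>b. Ric G w a b = 0)"
  using g_Ric_o g_nondegenerate[of w "Ric_o L G w a" 0] linear_0[OF linear_g1]
  by metis

end


section \<open>The contracted Bianchi identity\<close>

locale cartan_connection_on = finsler_connection_on S G L
  for S :: "'n::finite tcoord set" and G :: "'n conn" and L :: "'n tcoord \<Rightarrow> real" +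
  assumes metric_compatible: "smooth_on S V \<Longrightarrow> smooth_on S Y \<Longrightarrow> smooth_on S Z \<Longrightarrow> w \<in> S
      \<Longrightarrow> cov_tensor G V (finsler_metric L) Y Z w = 0"
    and torsion_free: "smooth_on S X \<Longrightarrow> smooth_on S Y \<Longrightarrow> w \<in> S
      \<Longrightarrow> torsion G (beta G X) (beta G Y) w = 0"
begin

abbreviation hcov :: "real ^ 'n \<Rightarrow> ('n tcoord \<Rightarrow> real ^ 'n) \<Rightarrow> 'n tcoord \<Rightarrow> real ^ 'n" where
  "hcov a \<equiv> cov G (beta G (\<lambda>_. a))"

abbreviation \<Gamma> :: "'n tcoord \<Rightarrow> real ^ 'n \<Rightarrow> real ^ 'n \<Rightarrow> real ^ 'n" where
  "\<Gamma> w a z \<equiv> G w (hlift G w a) z"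

lemma cov_const: "cov G X (\<lambda>_. z) w = G w (X w) z"
  by (simp add: cov_def)

lemma smooth_hcov: "smooth_on S f \<Longrightarrow> smooth_on S (hcov a f)"
  by (rule smooth_cov[OF smooth_hlift])

lemma cov_cong:
  assumes "\<And>u. u \<in> S \<Longrightarrow> f u = h u" "w \<in> S"
  shows "cov G X f w = cov G X h w"
  using frechet_derivative_cong_open[OF open_S assms(2,1)] assms by (simp add: cov_def)

lemma cov_diff:
  assumes "smooth_on S f" "smooth_on S h" "w \<in> S"
  shows "cov G X (\<lambda>u. f u - h u) w = cov G X f w - cov G X h w"
  using frechet_derivative_eq[OF has_derivative_diff[OF
      smooth_on_has_derivative[OF assms(1,3)] smooth_on_has_derivative[OF assms(2,3)]]]
  by (simp add: cov_def linear_diff[OF linear_G2[OF assms(3)]])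

lemma fst_dd_hlift:
  assumes w: "w \<in> S" shows "fst (dd (\<lambda>u. hlift G u a) w v) = 0"
proof -
  have "((\<lambda>u. fst (hlift G u a)) has_derivative (\<lambda>v. fst (dd (\<lambda>u. hlift G u a) w v))) (at w)"
    by (rule has_derivative_fst[OF smooth_on_has_derivative[OF smooth_hlift w]])
  then have "((\<lambda>u. a) has_derivative (\<lambda>v. fst (dd (\<lambda>u. hlift G u a) w v))) (at w)"
    by (rule has_derivative_transform_within_open[OF _ open_S w]) (rule fst_hlift)
  from fun_cong[OF frechet_derivative_eq[OF this], of v] show ?thesis
    by simp
qed

lemma fst_bracket_hlift: "w \<in> S \<Longrightarrow> fst (bracket (\<lambda>u. hlift G u a) (\<lambda>u. hlift G u b) w) = 0"
  by (simp add: bracket_def fst_dd_hlift)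

text \<open>
  The lifts of constant fields have a vertical bracket, so torsion-freeness on them is the symmetry of
  the horizontal coefficients.
\<close>

lemma \<Gamma>_sym:
  assumes w: "w \<in> S" shows "\<Gamma> w a b = \<Gamma> w b a"
proof -
  have "cov G X (rho (\<lambda>u. hlift G u c)) w = G w (X w) c" for X c
    using cov_cong[of "rho (\<lambda>u. hlift G u c)" "\<lambda>_. c", OF _ w] fst_hlift
    by (simp add: rho_def cov_const)
  moreover have "torsion G (\<lambda>u. hlift G u a) (\<lambda>u. hlift G u b) w = 0"
    by (rule torsion_free[OF smooth_on_const smooth_on_const w])
  ultimately show ?thesis
    by (simp add: torsion_def rho_def fst_bracket_hlift[OF w])
qed

lemma dd_g:
  assumes "smooth_on S Y" "smooth_on S Z" "w \<in> S"
  shows "dd (\<lambda>u. g u (Y u) (Z u)) w (hlift G w a) = g w (hcov a Y w) (Z w) + g w (Y w) (hcov a Z w)"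
  using metric_compatible[OF smooth_hlift assms, of a] by (simp add: cov_tensor_def)

text \<open>
  The value \<open>(\<nabla>\<^sub>a R)(b, c) z\<close> of the horizontal covariant derivative of the curvature, computed with
  constant extensions of the vectors: the derivative of a constant field is a value of \<open>\<Gamma>\<close>.
\<close>

definition nabla_curv ::
  "'n tcoord \<Rightarrow> real ^ 'n \<Rightarrow> real ^ 'n \<Rightarrow> real ^ 'n \<Rightarrow> real ^ 'n \<Rightarrow> real ^ 'n" where
  "nabla_curv w a b c z = hcov a (\<lambda>u. h_curvature G u b c z) w - h_curvature G w b c (\<Gamma> w a z)
     - h_curvature G w (\<Gamma> w a b) c z - h_curvature G w b (\<Gamma> w a c) z"

lemma nabla_curv_skew:
  assumes w: "w \<in> S" shows "nabla_curv w a c b z = - nabla_curv w a b c z"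
proof -
  have "hcov a (\<lambda>u. h_curvature G u c b z) w = hcov a (\<lambda>u. 0 - h_curvature G u b c z) w"
    by (rule cov_cong[OF _ w]) (simp add: h_curvature_skew[of _ c b])
  also have "\<dots> = - hcov a (\<lambda>u. h_curvature G u b c z) w"
    using cov_diff[OF smooth_on_const[of S 0] smooth_h_curvature w, of "beta G (\<lambda>_. a)" b c z]
    by (simp add: cov_const linear_0[OF linear_G2[OF w]])
  finally show ?thesis
    unfolding nabla_curv_def h_curvature_skew[OF w, of c b] h_curvature_skew[OF w, of "\<Gamma> w a c" b]
      h_curvature_skew[OF w, of c "\<Gamma> w a b"]
    by simp
qed

text \<open>
  The Ricci trace commutes with the covariant derivative, because the two terms in
  which the connection acts on the traced slots have the same trace.
\<close>

lemma trace_nabla_curv: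
  assumes w: "w \<in> S"
  shows "(\<Sum>i\<in>UNIV. nabla_curv w a b (axis i 1) z $ i)
    = cov_tensor G (beta G (\<lambda>_. a)) (Ric G) (\<lambda>_. b) (\<lambda>_. z) w"
proof -
  let ?R = "\<lambda>u c. h_curvature G u b c z"
  have der: "((\<lambda>u. \<Sum>i\<in>UNIV. ?R u (axis i 1) $ i) has_derivative
      (\<lambda>v. \<Sum>i\<in>UNIV. dd (\<lambda>u. ?R u (axis i 1)) w v $ i)) (at w)"
    by (intro has_derivative_sum
        bounded_linear.has_derivative[OF bounded_linear_vec_nth]
        smooth_on_has_derivative[OF smooth_h_curvature w])
  have "trace (matrix (\<lambda>c. \<Gamma> w a (?R w c))) = trace (matrix (\<lambda>c. ?R w (\<Gamma> w a c)))"
    by (rule trace_comp_commute[OF linear_G2[OF w] h_curvature_linear(2)[OF w]])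
  then have "(\<Sum>i\<in>UNIV. \<Gamma> w a (?R w (axis i 1)) $ i) = (\<Sum>i\<in>UNIV. ?R w (\<Gamma> w a (axis i 1)) $ i)"
    by (simp add: trace_matrix)
  moreover have "hcov a (\<lambda>u. ?R u c) w = dd (\<lambda>u. ?R u c) w (hlift G w a) + \<Gamma> w a (?R w c)" for c
    by (simp add: cov_def)
  ultimately show ?thesis
    using frechet_derivative_eq[OF der]
    by (simp add: nabla_curv_def cov_tensor_def Ric_eq cov_const sum.distrib sum_subtractf)
qed

end

text \<open>
  When the horizontal distribution is integrable, the horizontal lifts of constant fields commute:
  the bracket is vertical and, by the vanishing of the curvature on the fundamental field, also
  horizontal. Then the curvature is the commutator of the horizontal derivatives, and the Bianchi
  identity is the Jacobi identity.
\<close>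

locale integrable_cartan_connection_on = cartan_connection_on S G L
  for S :: "'n::finite tcoord set" and G :: "'n conn" and L :: "'n tcoord \<Rightarrow> real" +
  assumes R_hat_0: "w \<in> S \<Longrightarrow> R_hat G w a b = 0"
begin

lemma bracket_hlift:
  assumes w: "w \<in> S" shows "bracket (\<lambda>u. hlift G u a) (\<lambda>u. hlift G u b) w = 0"
proof -
  let ?B = "bracket (\<lambda>u. hlift G u a) (\<lambda>u. hlift G u b) w"
  have eta: "smooth_on S eta"
    using smooth_on_linear[OF open_S bounded_linear_snd] by (simp add: eta_def[abs_def])
  have hcov_eta: "hcov c eta u = 0" if "u \<in> S" for c u
    using hlift_horizontal[OF that, of c] horizontal_space_iff[of "hlift G u c" u]
    by (simp add: horizontal_space_def cov_def)
  have "hcov c (hcov d eta) w = 0" for c d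
    using cov_cong[of "hcov d eta" "\<lambda>_. 0", OF hcov_eta w] 
    by (simp add: cov_const linear_0[OF linear_G2[OF w]])
  moreover have "curvature G (\<lambda>u. hlift G u a) (\<lambda>u. hlift G u b) eta w = 0"
    using R_hat_0[OF w, of a b] curvature_eq[OF smooth_hlift smooth_hlift eta w]
    by (simp add: R_hat_def h_curvature_eq[OF w])
  ultimately have "cov G (bracket (\<lambda>u. hlift G u a) (\<lambda>u. hlift G u b)) eta w = 0"
    by (simp add: curvature_def)
  then have "?B \<in> horizontal_space G w"
    by (simp add: horizontal_space_def cov_def)
  then show ?thesis
    using horizontal_vertical_eq_0[OF w fst_bracket_hlift[OF w]] by (simp add: horizontal_space_iff)
qed

lemma h_curvature_commutator:
  assumes f: "smooth_on S f" and w: "w \<in> S"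
  shows "h_curvature G w a b (f w) = hcov b (hcov a f) w - hcov a (hcov b f) w"
proof -
  have "cov G (bracket (\<lambda>u. hlift G u a) (\<lambda>u. hlift G u b)) f w = 0"
    using linear_0[OF linear_frechet_derivative[OF smooth_on_differentiable[OF f w]]]
      linear_0[OF linear_G1[OF w]]
    by (simp add: cov_def bracket_hlift[OF w])
  then show ?thesis
    using curvature_eq[OF smooth_hlift smooth_hlift f w, of a b]
    by (simp add: h_curvature_eq[OF w] curvature_def)
qed

text \<open>
  The triple products of horizontal derivatives cancel in the cyclic sum (Jacobi identity), and
  the terms with the coefficients in the first two slots cancel by the symmetry of \<open>\<Gamma>\<close>.
\<close>

lemma bianchi:
  assumes w: "w \<in> S"
  shows "nabla_curv w a b c z + nabla_curv w b c a z + nabla_curv w c a b z = 0"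
proof -
  define E where "E a b c = hcov a (hcov b (hcov c (\<lambda>_. z))) w" for a b c
  have const: "smooth_on S (\<lambda>_. z)" by simp
  have 1: "hcov a (\<lambda>u. h_curvature G u b c z) w = E a c b - E a b c" for a b c
  proof -
    have "hcov a (\<lambda>u. h_curvature G u b c z) w
        = hcov a (\<lambda>u. hcov c (hcov b (\<lambda>_. z)) u - hcov b (hcov c (\<lambda>_. z)) u) w"
      by (rule cov_cong[OF _ w]) (rule h_curvature_commutator[OF const])
    then show ?thesis
      by (simp add: E_def cov_diff[OF smooth_hcov[OF smooth_hcov[OF const]] smooth_hcov[OF smooth_hcov[OF const]] w])
  qed
  have 2: "h_curvature G w b c (\<Gamma> w a z) = E c b a - E b c a" for a b c
    using h_curvature_commutator[OF smooth_hcov[OF const] w, of b c a]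
    by (simp add: E_def cov_const)
  have 3: "h_curvature G w c (\<Gamma> w b a) z = - h_curvature G w (\<Gamma> w a b) c z" for a b c
    using h_curvature_skew[OF w] \<Gamma>_sym[OF w, of a b] by metis
  show ?thesis
    unfolding nabla_curv_def 1 2
    unfolding 3[of c b a] 3[of a c b] 3[of b a c] by simp
qed

text \<open>
  The horizontal lifts commute also on the function \<open>g(z, v)\<close>, and the product rule turns their
  commutator into the curvature acting on either argument.
\<close>

lemma h_curvature_metric_skew:
  assumes w: "w \<in> S"
  shows "g w (h_curvature G w a b z) v + g w z (h_curvature G w a b v) = 0"
proof -
  let ?\<phi> = "\<lambda>u. g u z v"
  let ?z = "\<lambda>_::'n tcoord. z" and ?v = "\<lambda>_::'n tcoord. v"
  define h where "h c = (\<lambda>u. hlift G u c)" for c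
  have z: "smooth_on S ?z" and v: "smooth_on S ?v" by simp_all
  have second: "dd (\<lambda>u. dd ?\<phi> u (h c u)) w (h d w)
      = dd (\<lambda>u. dd ?\<phi> u (h c w)) w (h d w) + dd ?\<phi> w (dd (h c) w (h d w))" for c d
  proof -
    have "((\<lambda>u. dd ?\<phi> u (h c u)) has_derivative
        (\<lambda>x. dd (\<lambda>u. dd ?\<phi> u (h c w)) w x + dd ?\<phi> w (dd (h c) w x))) (at w)"
      by (rule has_derivative_linear_field[OF open_S w _ smooth_on_differentiable[OF smooth_on_dd[OF smooth_g] w]])
         (use w smooth_g in \<open>auto simp: h_def intro: linear_frechet_derivative smooth_on_differentiable
            smooth_on_has_derivative[OF smooth_hlift]\<close>)
    from frechet_derivative_eq[OF this] show ?thesis by simp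
  qed
  have lin: "linear (dd ?\<phi> w)"
    by (rule linear_frechet_derivative[OF smooth_on_differentiable[OF smooth_g w]])
  have br: "dd (h b) w (h a w) - dd (h a) w (h b w) = 0"
    using bracket_hlift[OF w, of a b] by (simp add: bracket_def h_def)
  have flat: "dd (\<lambda>u. dd ?\<phi> u (h b u)) w (h a w) - dd (\<lambda>u. dd ?\<phi> u (h a u)) w (h b w) = 0"
    using dd_dd_commute[OF open_S smooth_g w, of z v "h b w" "h a w"] linear_diff[OF lin] br linear_0[OF lin]
    unfolding second by (metis add_diff_cancel_left)
  have iter: "dd (\<lambda>u. dd ?\<phi> u (h c u)) w (h d w)
      = g w (hcov d (hcov c ?z) w) v + g w (hcov c ?z w) (hcov d ?v w)
      + (g w (hcov d ?z w) (hcov c ?v w) + g w z (hcov d (hcov c ?v) w))" for c d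
  proof -
    have sm: "smooth_on S (\<lambda>u. g u (Y u) (Z u))" if "smooth_on S Y" "smooth_on S Z" for Y Z
      by (rule smooth_on_bilinear_field[OF open_S bilinear_g smooth_g that])
    have "dd (\<lambda>u. dd ?\<phi> u (h c u)) w = dd (\<lambda>u. g u (hcov c ?z u) v + g u z (hcov c ?v u)) w"
      by (rule frechet_derivative_cong_open[OF open_S w]) (simp add: h_def dd_g[OF z v])
    also have "\<dots> = (\<lambda>x. dd (\<lambda>u. g u (hcov c ?z u) v) w x + dd (\<lambda>u. g u z (hcov c ?v u)) w x)"
      by (rule frechet_derivative_eq[OF has_derivative_add])
         (rule smooth_on_has_derivative[OF sm w]; simp add: smooth_hcov)+
    finally show ?thesis
      using dd_g[OF smooth_hcov[OF z, of c] v w, of d] dd_g[OF z smooth_hcov[OF v, of c] w, of d]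
      by (simp add: h_def)
  qed
  show ?thesis
    using flat
    unfolding iter h_curvature_commutator[OF z w] h_curvature_commutator[OF v w]
      linear_diff[OF linear_g1[OF w]] linear_diff[OF linear_g2[OF w]]
    by simp
qed

lemma nabla_curv_metric_skew:
  assumes w: "w \<in> S"
  shows "g w (nabla_curv w a b c z) v + g w z (nabla_curv w a b c v) = 0"
proof -
  let ?R = "\<lambda>u. h_curvature G u b c"
  have sm: "smooth_on S (\<lambda>u. g u (Y u) (Z u))" if "smooth_on S Y" "smooth_on S Z" for Y Z
    by (rule smooth_on_bilinear_field[OF open_S bilinear_g smooth_g that])
  have "dd (\<lambda>u. g u (?R u z) v + g u z (?R u v)) w = dd (\<lambda>_. 0) w"
    by (rule frechet_derivative_cong_open[OF open_S w]) (rule h_curvature_metric_skew)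
  moreover have "dd (\<lambda>u. g u (?R u z) v + g u z (?R u v)) w
      = (\<lambda>x. dd (\<lambda>u. g u (?R u z) v) w x + dd (\<lambda>u. g u z (?R u v)) w x)"
    by (rule frechet_derivative_eq[OF has_derivative_add])
       (rule smooth_on_has_derivative[OF sm w]; simp add: smooth_h_curvature)+
  ultimately have "dd (\<lambda>u. g u (?R u z) v) w (hlift G w a) + dd (\<lambda>u. g u z (?R u v)) w (hlift G w a) = 0"
    by (metis frechet_derivative_const)
  then have 1: "g w (hcov a (\<lambda>u. ?R u z) w) v + g w (?R w z) (\<Gamma> w a v)
      + (g w (\<Gamma> w a z) (?R w v) + g w z (hcov a (\<lambda>u. ?R u v) w)) = 0"
    using dd_g[OF smooth_h_curvature smooth_on_const w, of b c z v a]
      dd_g[OF smooth_on_const smooth_h_curvature w, of z b c v a]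
    by (simp add: cov_const)
  show ?thesis
    using 1 h_curvature_metric_skew[OF w, of b c z "\<Gamma> w a v"]
      h_curvature_metric_skew[OF w, of b c "\<Gamma> w a z" v]
      h_curvature_metric_skew[OF w, of "\<Gamma> w a b" c z v]
      h_curvature_metric_skew[OF w, of b "\<Gamma> w a c" z v]
    by (simp add: nabla_curv_def linear_diff[OF linear_g1[OF w]] linear_diff[OF linear_g2[OF w]])
qed

text \<open>
  The second Bianchi identity is contracted twice, once over the slots of the Ricci trace and once
  with the metric. The three terms become \<open>r \<kappa>(x)\<close> and twice \<open>-\<kappa>(Ric\<^sub>o x)\<close>, as recurrence turns each
  derivative of the Ricci tensor into a multiple of this tensor. Contraction uses the basis \<open>e\<close> which is
  dual to the standard basis with respect to the metric.
\<close>

lemma recurrence_form_eigen: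
  assumes w: "w \<in> S" and lin: "linear \<kappa>"
    and rec: "\<And>a b z. cov_tensor G (beta G (\<lambda>_. a)) (Ric G) (\<lambda>_. b) (\<lambda>_. z) w = \<kappa> a * Ric G w b z"
  shows "h_scalar L G w * \<kappa> x = 2 * \<kappa> (Ric_o L G w x)"
proof -
  have "\<exists>v. \<forall>b. g w v b = b $ i" for i
    using ex1_implies_ex[OF riesz[OF w, of "\<lambda>b. b $ i"]] by (simp add: linear_iff)
  then obtain e where e: "\<And>i b. g w (e i) b = b $ i"
    by metis
  let ?r = "h_scalar L G w" and ?R = "Ric_o L G w"
  have tr: "(\<Sum>i\<in>UNIV. g w (e i) (nabla_curv w a b (axis i 1) z)) = \<kappa> a * Ric G w b z" for a b z
    using trace_nabla_curv[OF w, of a b z] rec by (simp add: e)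
  have Ric_e: "Ric G w b (e j) = ?R b $ j" for b j
    using g_Ric_o[OF w, of b "e j"] g_sym[OF w, of "e j" "?R b"] e[of j "?R b"] by simp
  have \<kappa>: "(\<Sum>j\<in>UNIV. \<kappa> (axis j 1) * y $ j) = \<kappa> y" for y
  proof -
    have "\<kappa> y = \<kappa> (\<Sum>j\<in>UNIV. (y $ j) *\<^sub>R axis j 1)"
      using basis_expansion[of y] by (simp add: scalar_mult_eq_scaleR)
    then show ?thesis
      by (simp add: linear_sum[OF lin] linear_cmul[OF lin] mult.commute)
  qed
  have T1: "(\<Sum>j\<in>UNIV. \<Sum>i\<in>UNIV. g w (e i) (nabla_curv w x (axis j 1) (axis i 1) (e j))) = ?r * \<kappa> x"
    by (simp add: tr Ric_e h_scalar_def trace_matrix sum_distrib_left mult.commute)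
  have T2: "(\<Sum>j\<in>UNIV. \<Sum>i\<in>UNIV. g w (e i) (nabla_curv w (axis j 1) (axis i 1) x (e j))) = - \<kappa> (?R x)"
  proof -
    have "g w (e i) (nabla_curv w (axis j 1) (axis i 1) x (e j))
        = - g w (e i) (nabla_curv w (axis j 1) x (axis i 1) (e j))" for i j
      by (simp add: nabla_curv_skew[OF w, of _ "axis i 1" x] linear_neg[OF linear_g2[OF w]])
    then show ?thesis
      by (simp add: sum_negf tr Ric_e \<kappa>)
  qed
  have T3: "(\<Sum>j\<in>UNIV. \<Sum>i\<in>UNIV. g w (e i) (nabla_curv w (axis i 1) x (axis j 1) (e j))) = - \<kappa> (?R x)"
  proof -
    have "g w (e i) (nabla_curv w (axis i 1) x (axis j 1) (e j))
        = - g w (e j) (nabla_curv w (axis i 1) x (axis j 1) (e i))" for i j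
      using nabla_curv_metric_skew[OF w, of "axis i 1" x "axis j 1" "e j" "e i"] g_sym[OF w, of "e i"]
      by simp
    then have "(\<Sum>j\<in>UNIV. \<Sum>i\<in>UNIV. g w (e i) (nabla_curv w (axis i 1) x (axis j 1) (e j)))
        = (\<Sum>i\<in>UNIV. \<Sum>j\<in>UNIV. - g w (e j) (nabla_curv w (axis i 1) x (axis j 1) (e i)))"
      by (subst sum.swap) simp
    then show ?thesis
      by (simp add: sum_negf tr Ric_e \<kappa>)
  qed
  have "g w (e i) (nabla_curv w x (axis j 1) (axis i 1) (e j))
      + g w (e i) (nabla_curv w (axis j 1) (axis i 1) x (e j))
      + g w (e i) (nabla_curv w (axis i 1) x (axis j 1) (e j)) = 0" for i j
    using arg_cong[OF bianchi[OF w, of x "axis j 1" "axis i 1" "e j"], of "g w (e i)"]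
    by (simp only: linear_add[OF linear_g2[OF w]] linear_0[OF linear_g2[OF w]])
  then have "(\<Sum>j\<in>UNIV. \<Sum>i\<in>UNIV. g w (e i) (nabla_curv w x (axis j 1) (axis i 1) (e j))
      + g w (e i) (nabla_curv w (axis j 1) (axis i 1) x (e j))
      + g w (e i) (nabla_curv w (axis i 1) x (axis j 1) (e j))) = 0"
    by simp
  then show ?thesis
    unfolding sum.distrib T1 T2 T3 by simp
qed

text \<open>
  At \<open>Ric\<^sub>o x\<close> the relation \<open>r \<kappa> = 2 \<kappa> \<circ> Ric\<^sub>o\<close> reads \<open>r \<kappa>(Ric\<^sub>o x) = 2 \<alpha> \<kappa>(Ric\<^sub>o x)\<close>, and at \<open>x\<close> it shows
  that \<open>\<kappa>(Ric\<^sub>o x)\<close> can be cancelled.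
\<close>

lemma associated_scalar_of_recurrence:
  assumes "w \<in> S" "linear \<kappa>"
    and "\<And>a b z. cov_tensor G (beta G (\<lambda>_. a)) (Ric G) (\<lambda>_. b) (\<lambda>_. z) w = \<kappa> a * Ric G w b z"
    and sq: "\<And>x. Ric_o L G w (Ric_o L G w x) = \<alpha> *\<^sub>R Ric_o L G w x"
    and x: "\<kappa> x \<noteq> 0" and r: "h_scalar L G w \<noteq> 0"
  shows "h_scalar L G w = 2 * \<alpha>"
proof -
  note eigen = recurrence_form_eigen[OF assms(1-3)]
  have "\<kappa> (Ric_o L G w x) \<noteq> 0"
    using eigen[of x] x r by auto
  moreover have "h_scalar L G w * \<kappa> (Ric_o L G w x) = 2 * \<alpha> * \<kappa> (Ric_o L G w x)"
    using eigen[of "Ric_o L G w x"] by (simp add: sq linear_cmul[OF assms(2)])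
  ultimately show ?thesis by simp
qed

end


section \<open>Changes of coordinates\<close>

lemma smooth_on_comp_fst:
  fixes f :: "'a::real_normed_vector \<Rightarrow> 'c::real_normed_vector"
  assumes "open U" "open V" "smooth_on U f"
  shows "smooth_on (U \<times> V) (\<lambda>w. f (fst w))"
proof -
  have "Ck_on k f U \<Longrightarrow> Ck_on k (\<lambda>w. f (fst w)) (U \<times> V)" for k and f :: "'a \<Rightarrow> 'c"
  proof (induction k arbitrary: f)
    case 0
    then have "continuous_on (U \<times> V) (f \<circ> fst)"
      by (intro continuous_on_compose continuous_on_fst continuous_on_id)
         (auto intro: continuous_on_subset)
    then show ?case by (simp add: o_def)
  next
    case (Suc k)
    have der: "((\<lambda>w. f (fst w)) has_derivative (\<lambda>\<xi>. dd f (fst w) (fst \<xi>))) (at w)" if "w \<in> U \<times> V" for w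
      by (rule has_derivative_compose[OF has_derivative_fst[OF has_derivative_ident]])
         (use Suc.prems that in \<open>auto simp: frechet_derivative_works\<close>)
    have "Ck_on k (\<lambda>w. dd (\<lambda>w. f (fst w)) w \<xi>) (U \<times> V)" for \<xi>
      by (rule Ck_on_cong[OF open_Times[OF assms(1,2)] _ Suc.IH[of "\<lambda>x. dd f x (fst \<xi>)"]])
         (use frechet_derivative_eq[OF der] Suc.prems in auto)
    then show ?case
      using differentiableI[OF der] by simp
  qed
  then show ?thesis
    using assms(3) by (simp add: smooth_on_def)
qed

lemma trace_conjugate:
  fixes f f' J :: "real ^ 'n::finite \<Rightarrow> real ^ 'n"
  assumes J: "linear J" "inj J" and f: "linear f" and f': "\<And>x. f' (J x) = J (f x)"
  shows "trace (matrix f') = trace (matrix f)"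
proof -
  obtain I where I: "linear I" "\<And>x. I (J x) = x"
    using linear_injective_left_inverse[OF J] by (metis comp_apply id_apply)
  have JI: "J (I y) = y" for y
    using linear_inj_imp_surj[OF J] I(2) by (metis surjD)
  have "f' = (\<lambda>y. J (f (I y)))"
    using f' JI by metis
  then show ?thesis
    using trace_comp_commute[OF J(1) linear_compose[OF I(1) f, unfolded o_def]] I(2) by simp
qed

text \<open>
  A change \<open>\<tau>\<close> of the coordinates of \<open>M\<close> induces the change \<open>F(x, y) = (\<tau> x, D\<tau>(x) y)\<close> on the slit
  bundle, while \<open>\<pi>\<close>-vectors are transformed by the Jacobian \<open>J\<close> of \<open>\<tau>\<close>. The assumptions on \<open>L\<close> and \<open>G\<close>
  are the transformation laws of a function and of a linear connection.
\<close>

locale coordinate_change =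
  src: finsler_connection_on S G L + dst: finsler_connection_on S' G' L'
  for S S' :: "'n::finite tcoord set" and G G' :: "'n conn" and L L' :: "'n tcoord \<Rightarrow> real" +
  fixes U :: "(real ^ 'n) set" and \<tau> :: "real ^ 'n \<Rightarrow> real ^ 'n"
  assumes open_U: "open U" and smooth_\<tau>: "smooth_on U \<tau>"
    and inj_d\<tau>: "x \<in> U \<Longrightarrow> inj (dd \<tau> x)"
    and sub_src: "U \<times> (- {0}) \<subseteq> S"
    and sub_dst: "x \<in> U \<Longrightarrow> y \<noteq> 0 \<Longrightarrow> (\<tau> x, dd \<tau> x y) \<in> S'"
    and L_invariant: "x \<in> U \<Longrightarrow> y \<noteq> 0 \<Longrightarrow> L' (\<tau> x, dd \<tau> x y) = L (x, y)"
    and G_law: "x \<in> U \<Longrightarrow> y \<noteq> 0 \<Longrightarrow>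
      G' (\<tau> x, dd \<tau> x y) (dd (\<lambda>w. (\<tau> (fst w), dd \<tau> (fst w) (snd w))) (x, y) \<xi>) (dd \<tau> x z)
      = dd \<tau> x (G (x, y) \<xi> z) - dd (\<lambda>x. dd \<tau> x z) x (fst \<xi>)"
begin

definition T :: "'n tcoord set" where "T = U \<times> (- {0})"

definition F :: "'n tcoord \<Rightarrow> 'n tcoord" where "F w = (\<tau> (fst w), dd \<tau> (fst w) (snd w))"

abbreviation J :: "'n tcoord \<Rightarrow> real ^ 'n \<Rightarrow> real ^ 'n" where "J w \<equiv> dd \<tau> (fst w)"

lemma open_T: "open T"
  unfolding T_def by (intro open_Times open_U open_Compl closed_singleton)

lemma T_S: "w \<in> T \<Longrightarrow> w \<in> S"
  using sub_src by (auto simp: T_def)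

lemma T_iff: "w \<in> T \<longleftrightarrow> fst w \<in> U \<and> snd w \<noteq> 0"
  by (simp add: T_def mem_Times_iff)

lemma F_S': "w \<in> T \<Longrightarrow> F w \<in> S'"
  by (simp add: T_iff F_def sub_dst)

lemma linear_J: "w \<in> T \<Longrightarrow> linear (J w)"
  by (rule linear_frechet_derivative[OF smooth_on_differentiable[OF smooth_\<tau>]]) (auto simp: T_def)

lemma inj_J: "w \<in> T \<Longrightarrow> inj (J w)"
  by (rule inj_d\<tau>) (auto simp: T_def)

lemma surj_J: "w \<in> T \<Longrightarrow> surj (J w)"
  by (rule linear_inj_imp_surj[OF linear_J inj_J])

lemma smooth_J: "smooth_on T (\<lambda>w. J w z)"
  unfolding T_def
  by (rule smooth_on_comp_fst[OF open_U _ smooth_on_dd[OF smooth_\<tau>]]) (intro open_Compl closed_singleton)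

lemma dd_J: "w \<in> T \<Longrightarrow> dd (\<lambda>u. J u z) w \<xi> = dd (\<lambda>x. dd \<tau> x z) (fst w) (fst \<xi>)"
proof -
  assume "w \<in> T"
  then have "((\<lambda>u. J u z) has_derivative (\<lambda>\<xi>. dd (\<lambda>x. dd \<tau> x z) (fst w) (fst \<xi>))) (at w)"
    by (intro has_derivative_compose[OF has_derivative_fst[OF has_derivative_ident]]
        smooth_on_has_derivative[OF smooth_on_dd[OF smooth_\<tau>]]) (auto simp: T_def)
  then show ?thesis
    by (simp add: frechet_derivative_eq)
qed

lemma smooth_F: "smooth_on T F"
proof -
  have "smooth_on T (\<lambda>w. \<tau> (fst w))"
    unfolding T_def by (rule smooth_on_comp_fst[OF open_U _ smooth_\<tau>]) (intro open_Compl closed_singleton)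
  moreover have "smooth_on T (\<lambda>w. J w (snd w))"
    by (rule smooth_on_linear_field[where B = J, OF open_T linear_J smooth_J
          smooth_on_linear[OF open_T bounded_linear_snd]])
  ultimately show ?thesis
    unfolding F_def by (rule smooth_on_Pair[OF open_T])
qed

lemma dd_F:
  assumes w: "w \<in> T"
  shows "dd F w \<xi> = (J w (fst \<xi>), dd (\<lambda>u. J u (snd w)) w \<xi> + J w (snd \<xi>))"
proof -
  have 1: "((\<lambda>w. \<tau> (fst w)) has_derivative (\<lambda>\<xi>. J w (fst \<xi>))) (at w)"
    by (rule has_derivative_compose[OF has_derivative_fst[OF has_derivative_ident]
          smooth_on_has_derivative[OF smooth_\<tau>]]) (use w in \<open>auto simp: T_def\<close>)
  have 2: "((\<lambda>w. J w (snd w)) has_derivative (\<lambda>\<xi>. dd (\<lambda>u. J u (snd w)) w \<xi> + J w (snd \<xi>))) (at w)"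
    by (rule has_derivative_linear_field[where B = J, OF open_T w linear_J
          smooth_on_differentiable[OF smooth_J w] has_derivative_snd[OF has_derivative_ident]])
  have "(F has_derivative (\<lambda>\<xi>. (J w (fst \<xi>), dd (\<lambda>u. J u (snd w)) w \<xi> + J w (snd \<xi>)))) (at w)"
    unfolding F_def[abs_def] by (rule has_derivative_Pair[OF 1 2])
  then show ?thesis
    by (simp add: frechet_derivative_eq)
qed

lemma connection_law:
  "w \<in> T \<Longrightarrow> G' (F w) (dd F w \<xi>) (J w z) = J w (G w \<xi> z) - dd (\<lambda>u. J u z) w \<xi>"
  using G_law[of "fst w" "snd w" \<xi> z] by (simp add: T_iff dd_J F_def[abs_def])

lemma has_derivative_comp_F:
  assumes "w \<in> T" "smooth_on S' f"
  shows "((\<lambda>u. f (F u)) has_derivative (\<lambda>\<xi>. dd f (F w) (dd F w \<xi>))) (at w)"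
  by (rule has_derivative_compose[OF smooth_on_has_derivative[OF smooth_F assms(1)]
        smooth_on_has_derivative[OF assms(2) F_S'[OF assms(1)]]])

text \<open>
  The curvature contains derivatives of the coefficients; how these change is read off from the
  differentiated law.
\<close>

lemma dd_connection_law:
  assumes w: "w \<in> T"
  shows "dd (\<lambda>v. G' v (dd F w \<xi>) (J w z)) (F w) (dd F w \<zeta>)
      + G' (F w) (dd (\<lambda>u. dd F u \<xi>) w \<zeta>) (J w z) + G' (F w) (dd F w \<xi>) (dd (\<lambda>u. J u z) w \<zeta>)
    = dd (\<lambda>u. J u (G w \<xi> z)) w \<zeta> + J w (dd (\<lambda>u. G u \<xi> z) w \<zeta>)
      - dd (\<lambda>u. dd (\<lambda>u. J u z) u \<xi>) w \<zeta>"
proof -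
  have dF: "((\<lambda>u. dd F u \<xi>) has_derivative dd (\<lambda>u. dd F u \<xi>) w) (at w)"
    by (rule smooth_on_has_derivative[OF smooth_on_dd[OF smooth_F] w])
  have dJ: "((\<lambda>u. J u z) has_derivative dd (\<lambda>u. J u z) w) (at w)"
    by (rule smooth_on_has_derivative[OF smooth_J w])
  have dG: "((\<lambda>u. G u \<xi> z) has_derivative dd (\<lambda>u. G u \<xi> z) w) (at w)"
    by (rule smooth_on_has_derivative[OF src.smooth_G T_S[OF w]])
  have "((\<lambda>u. G' (F u) (dd F u \<xi>) (J u z)) has_derivative
      (\<lambda>\<zeta>. dd (\<lambda>u. G' (F u) (dd F w \<xi>) (J w z)) w \<zeta> + G' (F w) (dd (\<lambda>u. dd F u \<xi>) w \<zeta>) (J w z)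
        + G' (F w) (dd F w \<xi>) (dd (\<lambda>u. J u z) w \<zeta>))) (at w)"
    by (rule has_derivative_bilinear_field[where B = "\<lambda>u. G' (F u)", OF open_T w
          dst.bilinear_G[OF F_S'] differentiableI[OF has_derivative_comp_F[OF w dst.smooth_G]] dF dJ])
  then have lhs: "dd (\<lambda>u. G' (F u) (dd F u \<xi>) (J u z)) w \<zeta>
      = dd (\<lambda>v. G' v (dd F w \<xi>) (J w z)) (F w) (dd F w \<zeta>)
      + G' (F w) (dd (\<lambda>u. dd F u \<xi>) w \<zeta>) (J w z) + G' (F w) (dd F w \<xi>) (dd (\<lambda>u. J u z) w \<zeta>)"
    by (simp add: frechet_derivative_eq frechet_derivative_eq[OF has_derivative_comp_F[OF w dst.smooth_G]])
  have "((\<lambda>u. J u (G u \<xi> z) - dd (\<lambda>u. J u z) u \<xi>) has_derivative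
      (\<lambda>\<zeta>. (dd (\<lambda>u. J u (G w \<xi> z)) w \<zeta> + J w (dd (\<lambda>u. G u \<xi> z) w \<zeta>))
        - dd (\<lambda>u. dd (\<lambda>u. J u z) u \<xi>) w \<zeta>)) (at w)"
    by (rule has_derivative_diff[OF has_derivative_linear_field[where B = J, OF open_T w linear_J
          smooth_on_differentiable[OF smooth_J w] dG] smooth_on_has_derivative[OF smooth_on_dd[OF smooth_J] w]])
  then have rhs: "dd (\<lambda>u. J u (G u \<xi> z) - dd (\<lambda>u. J u z) u \<xi>) w \<zeta>
      = dd (\<lambda>u. J u (G w \<xi> z)) w \<zeta> + J w (dd (\<lambda>u. G u \<xi> z) w \<zeta>)
        - dd (\<lambda>u. dd (\<lambda>u. J u z) u \<xi>) w \<zeta>"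
    by (simp add: frechet_derivative_eq)
  have "dd (\<lambda>u. G' (F u) (dd F u \<xi>) (J u z)) w = dd (\<lambda>u. J u (G u \<xi> z) - dd (\<lambda>u. J u z) u \<xi>) w"
    by (rule frechet_derivative_cong_open[OF open_T w connection_law])
  then show ?thesis
    by (metis lhs rhs)
qed

text \<open>
  Antisymmetrization removes the second derivatives of the coordinate change from the differentiated
  law. What remains of first derivatives of \<open>J\<close> is compensated by the quadratic terms, to which the law
  itself applies twice.
\<close>

lemma curvature_law:
  assumes w: "w \<in> T"
  shows "coefficient_curvature G' (F w) (dd F w \<xi>) (dd F w \<zeta>) (J w z) = J w (coefficient_curvature G w \<xi> \<zeta> z)"
proof -
  have d: "dd (\<lambda>v. G' v (dd F w \<xi>) (J w z)) (F w) (dd F w \<zeta>)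
    = dd (\<lambda>u. J u (G w \<xi> z)) w \<zeta> + J w (dd (\<lambda>u. G u \<xi> z) w \<zeta>)
      - dd (\<lambda>u. dd (\<lambda>u. J u z) u \<xi>) w \<zeta>
      - G' (F w) (dd (\<lambda>u. dd F u \<xi>) w \<zeta>) (J w z) - G' (F w) (dd F w \<xi>) (dd (\<lambda>u. J u z) w \<zeta>)" for \<xi> \<zeta>
    using dd_connection_law[OF w, of \<xi> z \<zeta>] by (simp add: algebra_simps)
  have q: "G' (F w) (dd F w \<xi>) (G' (F w) (dd F w \<zeta>) (J w z))
    = J w (G w \<xi> (G w \<zeta> z)) - dd (\<lambda>u. J u (G w \<zeta> z)) w \<xi> - G' (F w) (dd F w \<xi>) (dd (\<lambda>u. J u z) w \<zeta>)"
    for \<xi> \<zeta>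
    by (simp add: connection_law[OF w] linear_diff[OF dst.linear_G2[OF F_S'[OF w]]])
  have s1: "dd (\<lambda>u. dd (\<lambda>u. J u z) u \<xi>) w \<zeta> = dd (\<lambda>u. dd (\<lambda>u. J u z) u \<zeta>) w \<xi>"
    by (rule dd_dd_commute[OF open_T smooth_J w])
  have s2: "dd (\<lambda>u. dd F u \<xi>) w \<zeta> = dd (\<lambda>u. dd F u \<zeta>) w \<xi>"
    by (rule dd_dd_commute[OF open_T smooth_F w])
  show ?thesis
    unfolding coefficient_curvature_def d q s1 s2
    by (simp add: linear_add[OF linear_J[OF w]] linear_diff[OF linear_J[OF w]] linear_neg[OF linear_J[OF w]])
qed

lemma hlift_law:
  assumes w: "w \<in> T" shows "hlift G' (F w) (J w a) = dd F w (hlift G w a)"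
proof -
  let ?\<xi> = "hlift G w a"
  have "snd (dd F w ?\<xi>) + G' (F w) (dd F w ?\<xi>) (snd (F w)) = J w (snd ?\<xi> + G w ?\<xi> (snd w))"
    using connection_law[OF w, of ?\<xi> "snd w"]
    by (simp add: dd_F[OF w] linear_add[OF linear_J[OF w]] F_def)
  also have "\<dots> = 0"
    by (simp only: src.hlift_horizontal[OF T_S[OF w]] linear_0[OF linear_J[OF w]])
  finally have "hlift G' (F w) (fst (dd F w ?\<xi>)) = dd F w ?\<xi>"
    by (rule dst.hlift_unique[OF F_S'[OF w]])
  then show ?thesis
    by (simp add: dd_F[OF w] src.fst_hlift[OF T_S[OF w]])
qed

lemma h_curvature_law:
  assumes "w \<in> T"
  shows "h_curvature G' (F w) (J w a) (J w b) (J w z) = J w (h_curvature G w a b z)"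
  using assms
  by (simp add: src.h_curvature_eq T_S dst.h_curvature_eq F_S' hlift_law curvature_law)

lemma Ric_law:
  assumes w: "w \<in> T" shows "Ric G' (F w) (J w a) (J w b) = Ric G w a b"
  unfolding Ric_def
  by (rule trace_conjugate[OF linear_J[OF w] inj_J[OF w]])
     (use w in \<open>auto intro: src.h_curvature_linear T_S simp: h_curvature_law\<close>)

text \<open>
  On vertical vectors the derivative of \<open>F\<close> is \<open>J\<close>, which does not change along the fibre. So the
  fibrewise Hessian of \<open>L\<^sup>2\<close> is transformed by \<open>J\<close> alone.
\<close>

lemma metric_law:
  assumes w: "w \<in> T" shows "finsler_metric L' (F w) (J w a) (J w b) = finsler_metric L w a b"
proof -
  let ?Q = "\<lambda>v. (L v)\<^sup>2" and ?Q' = "\<lambda>v. (L' v)\<^sup>2"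
  have vert: "dd F u (0, c) = (0, J u c)" if "u \<in> T" for u c
    using dd_J[OF that, of "snd u" "(0, c)"] linear_0[OF linear_J[OF that]]
      linear_0[OF linear_frechet_derivative[OF smooth_on_differentiable[OF smooth_on_dd[OF smooth_\<tau>]]], of "fst u"] that
    by (auto simp: dd_F[OF that] T_def)
  have vert_J: "dd (\<lambda>u. J u a) w (0, b) = 0"
    using vert[OF w, of b] dd_J[OF w, of a "(0, b)"]
      linear_0[OF linear_frechet_derivative[OF smooth_on_differentiable[OF smooth_on_dd[OF smooth_\<tau>]]], of "fst w"] w
    by (auto simp: T_def)
  have 1: "dd ?Q u (0, a) = dd ?Q' (F u) (0, J u a)" if u: "u \<in> T" for u
  proof -
    have "dd ?Q u = dd (\<lambda>u. ?Q' (F u)) u"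
      by (rule frechet_derivative_cong_open[OF open_T u]) (simp add: T_iff F_def L_invariant)
    then have "dd ?Q u (0, a) = dd (\<lambda>u. ?Q' (F u)) u (0, a)" by simp
    also have "\<dots> = dd ?Q' (F u) (dd F u (0, a))"
      by (simp add: frechet_derivative_eq[OF has_derivative_comp_F[OF u dst.smooth_L2]])
    finally show ?thesis
      by (simp add: vert[OF u])
  qed
  have lin: "linear (dd ?Q' (F u))" if "u \<in> T" for u
    by (rule linear_frechet_derivative[OF smooth_on_differentiable[OF dst.smooth_L2 F_S'[OF that]]])
  have dJ: "((\<lambda>u. (0 :: real ^ 'n, J u a)) has_derivative (\<lambda>\<xi>. (0, dd (\<lambda>u. J u a) w \<xi>))) (at w)"
    by (intro has_derivative_Pair has_derivative_const smooth_on_has_derivative[OF smooth_J w])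
  have "dd (\<lambda>u. dd ?Q u (0, a)) w = dd (\<lambda>u. dd ?Q' (F u) (0, J u a)) w"
    by (rule frechet_derivative_cong_open[OF open_T w 1])
  then have "dd (\<lambda>u. dd ?Q u (0, a)) w (0, b) = dd (\<lambda>u. dd ?Q' (F u) (0, J u a)) w (0, b)" by simp
  also have "\<dots> = dd (\<lambda>u. dd ?Q' (F u) (0, J w a)) w (0, b) + dd ?Q' (F w) (0, dd (\<lambda>u. J u a) w (0, b))"
    using frechet_derivative_eq[OF has_derivative_linear_field[where B = "\<lambda>u. dd ?Q' (F u)", OF open_T w lin
          differentiableI[OF has_derivative_comp_F[OF w smooth_on_dd[OF dst.smooth_L2]]] dJ]]
    by simp
  also have "\<dots> = dd (\<lambda>v. dd ?Q' v (0, J w a)) (F w) (0, J w b)"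
    using frechet_derivative_eq[OF has_derivative_comp_F[OF w smooth_on_dd[OF dst.smooth_L2]]]
      linear_0[OF lin[OF w]]
    by (simp add: vert_J vert[OF w] zero_prod_def)
  finally show ?thesis
    by (simp add: finsler_metric_eq[OF src.open_S src.smooth_L T_S[OF w]]
        finsler_metric_eq[OF dst.open_S dst.smooth_L F_S'[OF w]])
qed

lemma h_scalar_law:
  assumes w: "w \<in> T" shows "h_scalar L' G' (F w) = h_scalar L G w"
  unfolding h_scalar_def
proof (rule trace_conjugate[OF linear_J[OF w] inj_J[OF w] src.linear_Ric_o[OF T_S[OF w]]])
  fix a
  show "Ric_o L' G' (F w) (J w a) = J w (Ric_o L G w a)"
  proof (rule dst.g_nondegenerate[OF F_S'[OF w]])
    fix b'
    obtain b where "b' = J w b"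
      using surj_J[OF w] by (metis surjD)
    then show "finsler_metric L' (F w) (Ric_o L' G' (F w) (J w a)) b'
        = finsler_metric L' (F w) (J w (Ric_o L G w a)) b'"
      by (simp add: metric_law[OF w] dst.g_Ric_o[OF F_S'[OF w]] src.g_Ric_o[OF T_S[OF w]] Ric_law[OF w])
  qed
qed

end


section \<open>Globalization\<close>

lemma
  assumes "smooth_manifold M \<A>" "c \<in> \<A>"
  shows openin_chart: "openin M (fst c)"
    and open_chart_image: "open (snd c ` fst c)"
    and homeomorphic_chart: "homeomorphic_map (subtopology M (fst c)) (top_of_set (snd c ` fst c)) (snd c)"
  using assms by (auto simp: smooth_manifold_def)

lemma topspace_chart:
  assumes "smooth_manifold M \<A>" "c \<in> \<A>" shows "topspace (subtopology M (fst c)) = fst c"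
  using openin_subset[OF openin_chart[OF assms]] by (simp add: Int_absorb1)

lemma inj_on_chart:
  assumes "smooth_manifold M \<A>" "c \<in> \<A>" shows "inj_on (snd c) (fst c)"
  using homeomorphic_imp_injective_map[OF homeomorphic_chart[OF assms]] topspace_chart[OF assms] by simp

lemma transition_chart:
  assumes "smooth_manifold M \<A>" "c \<in> \<A>" "p \<in> fst c"
  shows "transition c d (snd c p) = snd d p"
  using inv_into_f_f[OF inj_on_chart[OF assms(1,2)] assms(3)] by (simp add: transition_def)

lemma open_overlap:
  assumes M: "smooth_manifold M \<A>" "c \<in> \<A>" "d \<in> \<A>" shows "open (overlap c d)"
proof -
  have "openin (subtopology M (fst c)) (fst c \<inter> fst d)"
    using openin_chart[OF M(1,3)] openin_subtopology_Int2 by blast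
  then have "openin (top_of_set (snd c ` fst c)) (overlap c d)"
    using homeomorphic_imp_open_map[OF homeomorphic_chart[OF M(1,2)]]
    by (simp add: open_map_def overlap_def)
  then show ?thesis
    using open_chart_image[OF M(1,2)] by (simp add: openin_open_eq)
qed

lemma open_slit: "smooth_manifold M \<A> \<Longrightarrow> c \<in> \<A> \<Longrightarrow> open (slit c)"
  unfolding slit_def by (intro open_Times open_chart_image open_Compl closed_singleton)

lemma smooth_transition:
  "smooth_manifold M \<A> \<Longrightarrow> c \<in> \<A> \<Longrightarrow> d \<in> \<A> \<Longrightarrow> smooth_on (overlap c d) (transition c d)"
  by (simp add: smooth_manifold_def)

text \<open>By the chain rule, the Jacobian of the reverse transition is a left inverse.\<close>

lemma inj_dtransition:
  assumes M: "smooth_manifold M \<A>" "c \<in> \<A>" "d \<in> \<A>" and x: "x \<in> overlap c d"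
  shows "inj (dd (transition c d) x)"
proof -
  have retr: "transition c d u \<in> overlap d c \<and> transition d c (transition c d u) = u" if "u \<in> overlap c d" for u
    using that transition_chart[OF M(1,2), of _ d] transition_chart[OF M(1,3), of _ c] by (auto simp: overlap_def)
  have "((\<lambda>u. transition d c (transition c d u)) has_derivative
      (\<lambda>v. dd (transition d c) (transition c d x) (dd (transition c d) x v))) (at x)"
    by (rule has_derivative_compose[OF smooth_on_has_derivative[OF smooth_transition[OF M] x]
          smooth_on_has_derivative[OF smooth_transition[OF M(1,3,2)]]]) (use retr x in blast)
  then have "((\<lambda>u. u) has_derivative
      (\<lambda>v. dd (transition d c) (transition c d x) (dd (transition c d) x v))) (at x)"
    by (rule has_derivative_transform_within_open[OF _ open_overlap[OF M] x]) (use retr in blast)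
  from fun_cong[OF frechet_derivative_eq[OF this]]
  have "dd (transition d c) (transition c d x) (dd (transition c d) x v) = v" for v
    by simp
  then show ?thesis
    by (metis injI)
qed

lemma finsler_connection_chart:
  assumes F: "finsler_manifold M \<A> L" and G: "cartan_connection \<A> L G" and c: "c \<in> \<A>"
  shows "finsler_connection_on (slit c) (G c) (L c)"
proof unfold_locales
  show "open (slit c)"
    using F c open_slit[of M \<A>] by (simp add: finsler_manifold_def)
  show "bilinear (G c w)" if "w \<in> slit c" for w
    using G c that by (simp add: cartan_connection_def linear_connection_def)
  show "smooth_on (slit c) (\<lambda>w. G c w \<xi> z)" for \<xi> z
    using G c unfolding cartan_connection_def linear_connection_def by blast
  show "regular_connection (slit c) (G c)"
    using G c by (simp add: cartan_connection_def)
  show "smooth_on (slit c) (L c)"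
    using F c by (simp add: finsler_manifold_def scalar_field_def)
  show "finsler_metric (L c) w a a > 0" if "w \<in> slit c" "a \<noteq> 0" for w a
    using F c that by (simp add: finsler_manifold_def)
qed

lemma cartan_connection_chart:
  assumes F: "finsler_manifold M \<A> L" and G: "cartan_connection \<A> L G" and c: "c \<in> \<A>"
  shows "cartan_connection_on (slit c) (G c) (L c)"
proof -
  interpret finsler_connection_on "slit c" "G c" "L c"
    by (rule finsler_connection_chart[OF assms])
  show ?thesis
    by unfold_locales (use G c in \<open>auto simp: cartan_connection_def\<close>)
qed

lemma coordinate_change_charts:
  assumes F: "finsler_manifold M \<A> L" and G: "cartan_connection \<A> L G" and c: "c \<in> \<A>" "d \<in> \<A>"
  shows "coordinate_change (slit c) (slit d) (G c) (G d) (L c) (L d) (overlap c d) (transition c d)"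
proof -
  have M: "smooth_manifold M \<A>"
    using F by (simp add: finsler_manifold_def)
  interpret src: finsler_connection_on "slit c" "G c" "L c"
    by (rule finsler_connection_chart[OF F G c(1)])
  interpret dst: finsler_connection_on "slit d" "G d" "L d"
    by (rule finsler_connection_chart[OF F G c(2)])
  have tangent: "tangent_transition c d w = (transition c d (fst w), dd (transition c d) (fst w) (snd w))" for w
    by (simp add: tangent_transition_def dtransition_def)
  show ?thesis
  proof unfold_locales
    show "open (overlap c d)" "smooth_on (overlap c d) (transition c d)"
      using open_overlap[OF M c] smooth_transition[OF M c] by auto
    show "inj (dd (transition c d) x)" if "x \<in> overlap c d" for x
      by (rule inj_dtransition[OF M c that])
    show "overlap c d \<times> - {0} \<subseteq> slit c"
      by (auto simp: overlap_def slit_def)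
    fix x y assume x: "x \<in> overlap c d" and y: "y \<noteq> (0 :: real ^ 'b)"
    have "dd (transition c d) x y \<noteq> 0"
    proof
      assume "dd (transition c d) x y = 0"
      then have "dd (transition c d) x y = dd (transition c d) x 0"
        using linear_0[OF linear_frechet_derivative[OF smooth_on_differentiable[OF smooth_transition[OF M c] x]]]
        by simp
      then show False
        using inj_dtransition[OF M c x] y by (auto dest: injD)
    qed
    moreover have "transition c d x \<in> snd d ` fst d"
      using x transition_chart[OF M c(1), of _ d] by (auto simp: overlap_def)
    ultimately show "(transition c d x, dd (transition c d) x y) \<in> slit d"
      by (simp add: slit_def)
    show "L d (transition c d x, dd (transition c d) x y) = L c (x, y)"
    proof -
      have "(x, y) \<in> overlap c d \<times> - {0}"
        using x y by simp
      then have "L d (tangent_transition c d (x, y)) = L c (x, y)"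
        using F c unfolding finsler_manifold_def scalar_field_def by blast
      then show ?thesis
        by (simp add: tangent)
    qed
    show "G d (transition c d x, dd (transition c d) x y)
        (dd (\<lambda>w. (transition c d (fst w), dd (transition c d) (fst w) (snd w))) (x, y) \<xi>)
        (dd (transition c d) x z)
      = dd (transition c d) x (G c (x, y) \<xi> z) - dd (\<lambda>x. dd (transition c d) x z) x (fst \<xi>)" for \<xi> z
    proof -
      have "(x, y) \<in> overlap c d \<times> - {0}"
        using x y by simp
      then have "G d (tangent_transition c d (x, y))
            (dd (tangent_transition c d) (x, y) \<xi>) (dtransition c d (fst (x, y)) z)
        = dtransition c d (fst (x, y)) (G c (x, y) \<xi> z)
          - dd (\<lambda>x. dtransition c d x z) (fst (x, y)) (fst \<xi>)"
        using G c unfolding cartan_connection_def linear_connection_def by blast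
      then show ?thesis
        by (simp add: tangent_transition_def[abs_def] dtransition_def)
    qed
  qed
qed

text \<open>
  The product of a ball and a punctured fibre is connected (this is where the dimension enters), so a
  continuous function with values in the natural numbers is constant on it. Together with the
  independence of the chart, this makes the function descend to a locally constant function on \<open>M\<close>.
\<close>

lemma natural_scalar_constant_on_component:
  fixes M :: "'p topology" and \<A> :: "('p, 'n::finite) chart set"
    and N :: "('p, 'n) chart \<Rightarrow> 'n tcoord \<Rightarrow> real"
  assumes M: "smooth_manifold M \<A>" and dim: "CARD('n) \<ge> 2"
    and cont: "\<And>c. c \<in> \<A> \<Longrightarrow> continuous_on (slit c) (N c)"
    and nat: "\<And>c w. c \<in> \<A> \<Longrightarrow> w \<in> slit c \<Longrightarrow> N c w \<in> \<nat>"
    and inv: "\<And>c d w. c \<in> \<A> \<Longrightarrow> d \<in> \<A> \<Longrightarrow> w \<in> overlap c d \<times> (- {0})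
      \<Longrightarrow> N d (tangent_transition c d w) = N c w"
    and C: "C \<in> connected_components_of M"
    and p: "c \<in> \<A>" "p \<in> C \<inter> fst c" "y \<noteq> 0" and q: "d \<in> \<A>" "q \<in> C \<inter> fst d" "z \<noteq> 0"
  shows "N c (snd c p, y) = N d (snd d q, z)"
proof -
  have slit: "(snd c p, y) \<in> slit c" if "p \<in> fst c" "y \<noteq> 0" for c p and y :: "real ^ 'n"
    using that by (simp add: slit_def)
  have const: "N c (x, y) = N c (x', y')"
    if "c \<in> \<A>" "connected B" "B \<subseteq> snd c ` fst c" "x \<in> B" "x' \<in> B" "y \<noteq> 0" "y' \<noteq> 0" for c B x x' y y'
  proof -
    have B: "B \<times> - {0} \<subseteq> slit c"
      using that(3) by (auto simp: slit_def)
    have conn: "connected (B \<times> - {0 :: real ^ 'n})"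
      using dim by (intro connected_Times that(2) connected_punctured_universe) simp
    have "N c constant_on B \<times> - {0}"
    proof (rule continuous_discrete_range_constant[OF conn continuous_on_subset[OF cont[OF that(1)] B]])
      fix w assume w: "w \<in> B \<times> - {0 :: real ^ 'n}"
      have "1 \<le> norm (N c w' - N c w)" if "w' \<in> B \<times> - {0}" "N c w' \<noteq> N c w" for w'
      proof -
        have "N c w \<in> \<nat>" "N c w' \<in> \<nat>"
          using nat[OF \<open>c \<in> \<A>\<close>] B w that by auto
        then obtain k m where "N c w = real k" "N c w' = real m"
          by (auto elim!: Nats_cases)
        then show ?thesis
          using that(2) by (auto simp: real_norm_def)
      qed
      then show "\<exists>e>0. \<forall>w'. w' \<in> B \<times> - {0} \<and> N c w' \<noteq> N c w \<longrightarrow> e \<le> norm (N c w' - N c w)"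
        by (intro exI[of _ 1]) auto
    qed
    then show ?thesis
      using that by (auto simp: constant_on_def)
  qed
  have indep: "N c (snd c p, y) = N d (snd d p, z)"
    if c: "c \<in> \<A>" "d \<in> \<A>" and p: "p \<in> fst c" "p \<in> fst d" and y: "y \<noteq> 0" "z \<noteq> 0" for c d p y z
  proof -
    have x: "snd c p \<in> overlap c d"
      using p by (simp add: overlap_def)
    have "dd (transition c d) (snd c p) y \<noteq> 0"
    proof
      assume "dd (transition c d) (snd c p) y = 0"
      then have "dd (transition c d) (snd c p) y = dd (transition c d) (snd c p) 0"
        using linear_0[OF linear_frechet_derivative[OF smooth_on_differentiable[OF smooth_transition[OF M c] x]]]
        by simp
      then show False
        using inj_dtransition[OF M c x] y by (auto dest: injD)
    qed
    then have "N d (snd d p, dd (transition c d) (snd c p) y) = N d (snd d p, z)"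
      using p y by (intro const[OF c(2), of "{snd d p}"]) auto
    moreover have "N d (snd d p, dd (transition c d) (snd c p) y) = N c (snd c p, y)"
      using inv[OF c, of "(snd c p, y)"] x y transition_chart[OF M c(1) p(1)]
      by (simp add: tangent_transition_def dtransition_def)
    ultimately show ?thesis by simp
  qed
  obtain y0 :: "real ^ 'n" where y0: "y0 \<noteq> 0"
    using p(3) by blast
  \<comment> \<open>The chart and the direction are arbitrary here, by \<open>indep\<close>.\<close>
  define ch where "ch p = (SOME c. c \<in> \<A> \<and> p \<in> fst c)" for p
  define n where "n p = N (ch p) (snd (ch p) p, y0)" for p
  have n_eq: "n p = N c (snd c p, y)" if "c \<in> \<A>" "p \<in> fst c" "y \<noteq> 0" for c p y
  proof -
    have "ch p \<in> \<A> \<and> p \<in> fst (ch p)"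
      unfolding ch_def by (rule someI[of _ c]) (use that in simp)
    then show ?thesis
      unfolding n_def by (intro indep) (use that y0 in auto)
  qed
  have "continuous_map M (discrete_topology UNIV) n"
    unfolding continuous_map_def
  proof (intro conjI allI impI)
    show "n \<in> topspace M \<rightarrow> topspace (discrete_topology UNIV)" by simp
    fix V :: "real set"
    show "openin M {p \<in> topspace M. n p \<in> V}"
    proof (subst openin_subopen, intro ballI)
      fix p assume pV: "p \<in> {p \<in> topspace M. n p \<in> V}"
      then have "p \<in> \<Union> (fst ` \<A>)"
        using M by (simp add: smooth_manifold_def)
      then obtain c where c: "c \<in> \<A>" "p \<in> fst c" by blast
      obtain r where r: "r > 0" "ball (snd c p) r \<subseteq> snd c ` fst c"
        using open_chart_image[OF M c(1)] c(2) open_contains_ball by (metis imageI)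
      let ?W = "{q \<in> fst c. snd c q \<in> ball (snd c p) r}"
      have "openin (top_of_set (snd c ` fst c)) (ball (snd c p) r)"
        using r(2) by (simp add: openin_open_eq open_chart_image[OF M c(1)])
      then have "openin (subtopology M (fst c)) ?W"
        using openin_continuous_map_preimage[OF homeomorphic_imp_continuous_map[OF homeomorphic_chart[OF M c(1)]]]
        unfolding topspace_chart[OF M c(1)] by blast
      then have "openin M ?W"
        using openin_chart[OF M c(1)] openin_trans_full by blast
      moreover have "p \<in> ?W"
        using c r by simp
      moreover have "?W \<subseteq> {p \<in> topspace M. n p \<in> V}"
      proof
        fix q assume q: "q \<in> ?W"
        have "N c (snd c q, y0) = N c (snd c p, y0)"
          by (rule const[OF c(1) connected_ball r(2)]) (use q r y0 in auto)
        then have "n q = n p"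
          using n_eq[OF c(1) _ y0] q c(2) by simp
        then show "q \<in> {p \<in> topspace M. n p \<in> V}"
          using pV q openin_subset[OF openin_chart[OF M c(1)]] by auto
      qed
      ultimately show "\<exists>W. openin M W \<and> p \<in> W \<and> W \<subseteq> {p \<in> topspace M. n p \<in> V}"
        by blast
    qed
  qed
  from connectedin_continuous_map_image[OF this connectedin_connected_components_of[OF C]]
  have "n p = n q"
    using p(2) q(2) by (auto simp: connectedin_discrete_topology)
  then show ?thesis
    using n_eq[of c p y] n_eq[of d q z] p q by simp
qed

theorem theorem2p3:
  fixes M :: "'p topology"
    and \<A> :: "('p, 'n::finite) chart set"
    and L :: "('p, 'n) chart \<Rightarrow> 'n tcoord \<Rightarrow> real"
    and G :: "('p, 'n) chart \<Rightarrow> 'n conn"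
    and \<alpha> :: "('p, 'n) chart \<Rightarrow> 'n tcoord \<Rightarrow> real"
  assumes "CARD('n) \<ge> 3"
    and "finsler_manifold M \<A> L"
    and "cartan_connection \<A> L G"
    and "generalized_ricci M \<A> L G \<alpha>"
  shows "(ricci_symmetric \<A> G \<longrightarrow>
            (\<forall>c\<in>\<A>. \<forall>w \<in> slit c. h_scalar (L c) (G c) w \<noteq> 0))
       \<and> (\<forall>c\<in>\<A>. \<forall>w \<in> slit c. \<forall>v. Ric_o (L c) (G c) w v \<noteq> 0 \<longrightarrow>
            Ric_direction (L c) (G c) w (Ric_o (L c) (G c) w v) = \<alpha> c w)
       \<and> (\<forall>c\<in>\<A>. \<forall>w \<in> slit c. eigenvalues (Ric_o (L c) (G c) w) =
            (if \<forall>v. Ric_o (L c) (G c) w v = \<alpha> c w *\<^sub>R v then {\<alpha> c w} else {0, \<alpha> c w}))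
       \<and> (horizontally_integrable \<A> G \<and> ricci_recurrent M \<A> G \<longrightarrow>
            (\<forall>c\<in>\<A>. \<forall>w \<in> slit c. \<alpha> c w = h_scalar (L c) (G c) w / 2))"
proof -
  note Fin = assms(2) and Car = assms(3) and Gen = assms(4)
  have M: "smooth_manifold M \<A>"
    using Fin by (simp add: finsler_manifold_def)
  have \<alpha>0: "\<alpha> c w \<noteq> 0" if "c \<in> \<A>" "w \<in> slit c" for c w
    using Gen that by (simp add: generalized_ricci_def)
  have sq: "Ric_o (L c) (G c) w (Ric_o (L c) (G c) w a) = \<alpha> c w *\<^sub>R Ric_o (L c) (G c) w a"
    if "c \<in> \<A>" "w \<in> slit c" for c w a
    using Gen that by (simp add: generalized_ricci_def)
  have scal: "scalar_field \<A> \<alpha>"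
    using Gen by (simp add: generalized_ricci_def)
  note loc = finsler_connection_chart[OF Fin Car]
  \<comment> \<open>The rank of the Ricci operator, written as a quotient of continuous functions.\<close>
  define N where "N c w = h_scalar (L c) (G c) w / \<alpha> c w" for c w
  have N_dim: "N c w = dim (range (Ric_o (L c) (G c) w))" if "c \<in> \<A>" "w \<in> slit c" for c w
    unfolding N_def h_scalar_def
    by (rule trace_scaled_idempotent[OF finsler_connection_on.linear_Ric_o[OF loc[OF that(1)] that(2)]
          sq[OF that] \<alpha>0[OF that]])
  have N_const: "N c (snd c p, y) = N d (snd d q, z)"
    if "C \<in> connected_components_of M" "c \<in> \<A>" "p \<in> C \<inter> fst c" "y \<noteq> 0"
      "d \<in> \<A>" "q \<in> C \<inter> fst d" "z \<noteq> 0" for C c p y d q z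
  proof (rule natural_scalar_constant_on_component[OF M _ _ _ _ that])
    show "2 \<le> CARD('n)" using assms(1) by simp
    show "continuous_on (slit c) (N c)" if c: "c \<in> \<A>" for c
    proof -
      have "continuous_on (slit c) (\<alpha> c)"
        using scal c smooth_on_continuous by (auto simp: scalar_field_def)
      then show ?thesis
        unfolding N_def[abs_def]
        by (intro continuous_on_divide finsler_connection_on.continuous_h_scalar[OF loc[OF c]])
           (use \<alpha>0[OF c] in auto)
    qed
    show "N c w \<in> \<nat>" if "c \<in> \<A>" "w \<in> slit c" for c w
      using N_dim[OF that] by simp
    fix c d and w :: "'n tcoord" assume cd: "c \<in> \<A>" "d \<in> \<A>" and w: "w \<in> overlap c d \<times> (- {0})"
    interpret coordinate_change "slit c" "slit d" "G c" "G d" "L c" "L d" "overlap c d" "transition c d"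
      by (rule coordinate_change_charts[OF Fin Car cd])
    have "tangent_transition c d w = F w"
      by (simp add: F_def tangent_transition_def dtransition_def)
    moreover have "\<alpha> d (tangent_transition c d w) = \<alpha> c w"
      using scal cd w unfolding scalar_field_def by blast
    ultimately show "N d (tangent_transition c d w) = N c w"
      using h_scalar_law[of w] w by (simp add: N_def T_def)
  qed
  have comp: "\<exists>p y C. w = (snd c p, y) \<and> y \<noteq> 0 \<and> C \<in> connected_components_of M \<and> p \<in> C \<inter> fst c"
    if c: "c \<in> \<A>" and sl: "w \<in> slit c" for c w
  proof -
    obtain p y where w: "w = (snd c p, y)" "p \<in> fst c" "y \<noteq> 0"
      using sl by (auto simp: slit_def)
    then have "p \<in> topspace M"
      using openin_subset[OF openin_chart[OF M c]] by blast
    then obtain C where "C \<in> connected_components_of M" "p \<in> C"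
      using Union_connected_components_of[of M] by blast
    then show ?thesis
      using w by blast
  qed
  have nz: "\<forall>C \<in> connected_components_of M. \<exists>c\<in>\<A>. \<exists>p \<in> C \<inter> fst c. \<exists>y. y \<noteq> 0 \<and>
      (\<exists>a b. Ric (G c) (snd c p, y) a b \<noteq> 0)"
    using Gen unfolding generalized_ricci_def nonzero_ricci_def nonzero_field_def by (elim conjE)
  have N_nz: "N c w \<noteq> 0" if c: "c \<in> \<A>" and w: "w \<in> slit c" for c w
  proof -
    obtain p y C where p: "w = (snd c p, y)" "y \<noteq> 0" "C \<in> connected_components_of M" "p \<in> C \<inter> fst c"
      using comp[OF c w] by blast
    obtain d q z a b where d: "d \<in> \<A>" "q \<in> C \<inter> fst d" "z \<noteq> 0" "Ric (G d) (snd d q, z) a b \<noteq> 0"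
      using bspec[OF nz p(3)] by blast
    have sl: "(snd d q, z) \<in> slit d"
      using d by (simp add: slit_def)
    have "Ric_o (L d) (G d) (snd d q, z) a \<noteq> 0"
      using finsler_connection_on.Ric_o_eq_0_iff[OF loc[OF d(1)] sl] d(4) by blast
    then have "N d (snd d q, z) \<noteq> 0"
      unfolding N_dim[OF d(1) sl] by (auto simp: dim_eq_0)
    then show ?thesis
      using N_const[OF p(3) c p(4,2) d(1-3)] p(1) by simp
  qed
  have r_nz: "h_scalar (L c) (G c) w \<noteq> 0" if "c \<in> \<A>" "w \<in> slit c" for c w
    using N_nz[OF that] by (auto simp: N_def)
  have dir: "Ric_direction (L c) (G c) w (Ric_o (L c) (G c) w v) = \<alpha> c w"
    if c: "c \<in> \<A>" and w: "w \<in> slit c" and v: "Ric_o (L c) (G c) w v \<noteq> 0" for c w v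
  proof -
    interpret finsler_connection_on "slit c" "G c" "L c" by (rule loc[OF c])
    show ?thesis
      using pos[OF w v]
      by (simp add: Ric_direction_def g_Ric_o[OF w, symmetric] sq[OF c w] linear_cmul[OF linear_g1[OF w]])
  qed
  have eig: "eigenvalues (Ric_o (L c) (G c) w) =
      (if \<forall>v. Ric_o (L c) (G c) w v = \<alpha> c w *\<^sub>R v then {\<alpha> c w} else {0, \<alpha> c w})"
    if c: "c \<in> \<A>" and w: "w \<in> slit c" for c w
  proof -
    have "\<exists>a. Ric_o (L c) (G c) w a \<noteq> 0"
      using N_nz[OF that] N_dim[OF that] by (auto simp: dim_eq_0)
    then show ?thesis
      using eigenvalues_scaled_idempotent[OF finsler_connection_on.linear_Ric_o[OF loc[OF c] w] sq[OF that]]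
      by blast
  qed
  have half: "\<alpha> c w = h_scalar (L c) (G c) w / 2"
    if int: "horizontally_integrable \<A> G" and rec: "ricci_recurrent M \<A> G" and c: "c \<in> \<A>" and w: "w \<in> slit c"
    for c w
  proof -
    obtain p y C where p: "w = (snd c p, y)" "y \<noteq> 0" "C \<in> connected_components_of M" "p \<in> C \<inter> fst c"
      using comp[OF c w] by blast
    obtain A where A: "pi_form \<A> A" "nonzero_field M \<A> (\<lambda>c w. \<exists>v. A c w v \<noteq> 0)"
      and R: "\<And>c X Y Z w. c \<in> \<A> \<Longrightarrow> smooth_on (slit c) X \<Longrightarrow> smooth_on (slit c) Y \<Longrightarrow> smooth_on (slit c) Z
        \<Longrightarrow> w \<in> slit c \<Longrightarrow> cov_tensor (G c) (beta (G c) X) (Ric (G c)) Y Z w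
              = A c w (X w) * Ric (G c) w (Y w) (Z w)"
      using rec unfolding ricci_recurrent_def by blast
    obtain d q z v where d: "d \<in> \<A>" "q \<in> C \<inter> fst d" "z \<noteq> 0" "A d (snd d q, z) v \<noteq> 0"
      using bspec[OF A(2)[unfolded nonzero_field_def] p(3)] by blast
    have sl: "(snd d q, z) \<in> slit d"
      using d by (simp add: slit_def)
    interpret cartan_connection_on "slit d" "G d" "L d"
      by (rule cartan_connection_chart[OF Fin Car d(1)])
    interpret integrable_cartan_connection_on "slit d" "G d" "L d"
      by unfold_locales (use int d(1) in \<open>simp add: horizontally_integrable_def\<close>)
    have "h_scalar (L d) (G d) (snd d q, z) = 2 * \<alpha> d (snd d q, z)"
    proof (rule associated_scalar_of_recurrence[where \<kappa> = "A d (snd d q, z)", OF sl _ _ sq[OF d(1) sl] d(4) r_nz[OF d(1) sl]])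
      show "linear (A d (snd d q, z))"
        using A(1) d(1) sl by (simp add: pi_form_def)
    qed (use R[OF d(1) smooth_on_const smooth_on_const smooth_on_const sl] in simp)
    then have "N d (snd d q, z) = 2"
      using \<alpha>0[OF d(1) sl] by (simp add: N_def)
    then have "N c w = 2"
      using N_const[OF p(3) c p(4,2) d(1-3)] p(1) by simp
    then show ?thesis
      using \<alpha>0[OF c w] by (simp add: N_def field_simps)
  qed
  show ?thesis
    using r_nz dir eig half by blast
qed

end
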